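(* Suppose that the radial sampling density $q:\mathbb{R}^d\to(0,\infty)$ has exponential decay, with associated function $\psi$, and that $$r_n\,\psi'(\psi^{\leftarrow}(\log n))=O(1)\quad (n\to\infty).$$ Then with high probability $G(\mathcal{P}_n,r_n)$ is disconnected, i.e. $\lim_{n\to\infty}\mathbb{P}(G(\mathcal{P}_n,r_n)\text{ is disconnected})=1$.
   Context: Let $d\ge 2$ and let $\nu$ be a probability measure on $\mathbb{R}^d$ with density $q:\mathbb{R}^d\to(0,\infty)$ that is radial, i.e. $q(x)$ depends only on $|x|$. $\mathcal{P}_n$ is the Poisson point process of intensity $n\nu$: $\mathcal{P}_n=\{x_1,\dots,x_N\}$ with $N\sim \mathrm{Po}(n)$ independent of the $x_i$, which are i.i.d. with law $\nu$. The radius $r_n$ satisfies $0<r_n\le 1$ and is non-increasing in $n$. $G(\mathcal{P}_n,r_n)$ is the graph with vertex set $\mathcal{P}_n$ in which two distinct points are joined by an edge iff their Euclidean distance is less than $r_n$. A function $f:(0,\infty)\to(0,\infty)$ is regularly varying with exponent $\alpha\in\mathbb{R}$, written $f\in RV_\alpha$, if $\lim_{R\to\infty} f(tR)/f(R)=t^\alpha$ for all $t>0$. A function $\psi\in C^2([0,\infty);[0,\infty))$ is of von Mises type if $\psi'(z)>0$ for all sufficiently large $z$, $\psi(z)\to\infty$ as $z\to\infty$, and $a'(z)\to 0$ as $z\to\infty$, where $a(z):=1/\psi'(z)$; then $\psi^{\leftarrow}$ denotes any function that is asymptotically (for large arguments) the inverse of $\psi$. A radial density $q$ has a light tail if it can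 be written as $q(x)=L(|x|)\exp(-\psi(|x|))$ where $\psi\in C^2([0,\infty);[0,\infty))$ is of von Mises type, $\psi'$ is eventually monotone, and $L\in RV_\alpha$ for some $\alpha\in\mathbb{R}$. The density $q$ has exponential decay if it has a light tail with $\psi\in RV_1$. *)

theory Defs
  imports
    "HOL-Probability.Probability"
    "HOL-Library.Landau_Symbols"
    "Graph_Theory.Digraph_Component"
begin

text \<open>
  Poisson point process of intensity \<open>c \<cdot> \<nu>\<close>, realised on a probability space \<open>M\<close> as
  \<open>{X 0, \<dots>, X (N - 1)}\<close>. The last conjunct is independence of \<open>N\<close> and the whole sequence \<open>X\<close>;
  it is phrased through the generated \<open>\<sigma>\<close>-algebras because \<open>indep_var\<close> only relates random
  variables of the same type.
\<close>

definition poisson_sample ::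
  "real \<Rightarrow> 'a::euclidean_space measure \<Rightarrow> 'w measure \<Rightarrow> ('w \<Rightarrow> nat) \<Rightarrow> (nat \<Rightarrow> 'w \<Rightarrow> 'a) \<Rightarrow> bool" where
  "poisson_sample c \<nu> M N X \<longleftrightarrow>
     prob_space M \<and>
     N \<in> measurable M (count_space UNIV) \<and>
     distr M (count_space UNIV) N = measure_pmf (poisson_pmf c) \<and>
     (\<forall>i. distr M borel (X i) = \<nu>) \<and>
     prob_space.indep_vars M (\<lambda>_. borel) X UNIV \<and>
     prob_space.indep_set M
       {N -` A \<inter> space M | A. A \<in> sets (count_space UNIV)}
       {(\<lambda>\<omega> i. X i \<omega>) -` B \<inter> space M | B. B \<in> sets (Pi\<^sub>M UNIV (\<lambda>_::nat. borel))}"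

definition poisson_points :: "('w \<Rightarrow> nat) \<Rightarrow> (nat \<Rightarrow> 'w \<Rightarrow> 'a) \<Rightarrow> 'w \<Rightarrow> 'a set" where
  "poisson_points N X \<omega> = (\<lambda>i. X i \<omega>) ` {..<N \<omega>}"

definition geometric_graph :: "'a::metric_space set \<Rightarrow> real \<Rightarrow> 'a pair_pre_digraph" where
  "geometric_graph P \<rho> =
     \<lparr>pverts = P, parcs = {(x, y). x \<in> P \<and> y \<in> P \<and> x \<noteq> y \<and> dist x y < \<rho>}\<rparr>"

text \<open>
  \<open>connected\<close> alone would be ambiguous between topology and graph theory. The graph-theoretic notion
  does not count the empty graph as connected.
\<close>

definition disconnected_graph :: "'a pair_pre_digraph \<Rightarrow> bool" where
  "disconnected_graph G \<longleftrightarrow> \<not> Digraph_Component.connected (with_proj G)"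

definition radial :: "('a::real_normed_vector \<Rightarrow> real) \<Rightarrow> bool" where
  "radial q \<longleftrightarrow> (\<forall>x y. norm x = norm y \<longrightarrow> q x = q y)"

text \<open>
  Positivity is demanded only for large arguments, so that the notion also applies to functions
  with values in \<open>[0, \<infinity>)\<close> that tend to infinity, such as \<open>\<psi>\<close> below.
\<close>

definition regularly_varying :: "real \<Rightarrow> (real \<Rightarrow> real) \<Rightarrow> bool" where
  "regularly_varying \<alpha> f \<longleftrightarrow>
     (\<forall>\<^sub>F z in at_top. f z > 0) \<and>
     (\<forall>t>0. ((\<lambda>R. f (t * R) / f R) \<longlongrightarrow> t powr \<alpha>) at_top)"

text \<open>
  Functions on \<open>[0, \<infinity>)\<close> are represented by functions on \<open>real\<close> whose values at negative arguments
  are irrelevant; at \<open>0\<close> the derivatives are one-sided. On \<open>(0, \<infinity>)\<close> the first derivative is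
  \<open>deriv \<psi>\<close>.
\<close>

definition C2_halfline :: "(real \<Rightarrow> real) \<Rightarrow> bool" where
  "C2_halfline \<psi> \<longleftrightarrow>
     (\<exists>\<psi>1 \<psi>2.
        (\<forall>z\<ge>0. (\<psi> has_real_derivative \<psi>1 z) (at z within {0..})) \<and>
        (\<forall>z\<ge>0. (\<psi>1 has_real_derivative \<psi>2 z) (at z within {0..})) \<and>
        continuous_on {0..} \<psi>2)"

definition von_mises :: "(real \<Rightarrow> real) \<Rightarrow> bool" where
  "von_mises \<psi> \<longleftrightarrow>
     C2_halfline \<psi> \<and> (\<forall>z\<ge>0. \<psi> z \<ge> 0) \<and>
     (\<forall>\<^sub>F z in at_top. deriv \<psi> z > 0) \<and>
     filterlim \<psi> at_top at_top \<and>
     ((\<lambda>z. deriv (\<lambda>y. 1 / deriv \<psi> y) z) \<longlongrightarrow> 0) at_top"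

definition asymptotic_inverse :: "(real \<Rightarrow> real) \<Rightarrow> (real \<Rightarrow> real) \<Rightarrow> bool" where
  "asymptotic_inverse \<psi> \<phi> \<longleftrightarrow>
     (\<forall>\<^sub>F z in at_top. \<phi> (\<psi> z) = z) \<and> (\<forall>\<^sub>F y in at_top. \<psi> (\<phi> y) = y)"

text \<open>
  The representation is required for all \<open>x\<close>, including \<open>x = 0\<close>, where it merely fixes the value
  \<open>L 0\<close>, which lies outside the domain \<open>(0, \<infinity>)\<close> of \<open>L\<close>.
\<close>

definition light_tail :: "('a::euclidean_space \<Rightarrow> real) \<Rightarrow> (real \<Rightarrow> real) \<Rightarrow> bool" where
  "light_tail q \<psi> \<longleftrightarrow>
     von_mises \<psi> \<and>
     (\<exists>z0. mono_on {z0..} (deriv \<psi>) \<or> antimono_on {z0..} (deriv \<psi>)) \<and>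
     (\<exists>L \<alpha>. (\<forall>z>0. L z > 0) \<and> regularly_varying \<alpha> L \<and>
        (\<forall>x. q x = L (norm x) * exp (- \<psi> (norm x))))"

definition exponential_decay :: "('a::euclidean_space \<Rightarrow> real) \<Rightarrow> (real \<Rightarrow> real) \<Rightarrow> bool" where
  "exponential_decay q \<psi> \<longleftrightarrow> light_tail q \<psi> \<and> regularly_varying 1 \<psi>"

end

(* Let Y = psi^{<-}(log n). Monotonicity of psi' and psi in RV_1 give psi'(s) ~ psi(s)/s, so near
   radius Y the function psi varies by O(1) at scale rho = min 1 (C Y / log n) >= r_n; by the uniform
   convergence theorem for regularly varying functions L varies by a bounded factor there. Since
   n q(s) rho^d passes from large to small values between Y/2 and 2Y, it is bounded above and below in
   a 2 rho-neighbourhood of some radius R. Hence, for every unit vector u, with probability bounded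
   below exactly one point falls into the ball of radius 2 rho about R u, and it lies in the
   concentric ball of radius rho, so it is isolated. For K fixed directions u and n large these events
   are pairwise independent, and by Chebyshev's inequality at least two of them occur with
   probability 1 - O(1/K). *)

theory Submission
  imports Defs "HOL-Real_Asymp.Real_Asymp"
begin

text \<open>The radius \<open>r n\<close> has no lower bound, so at its own scale the expected
  number of points in a ball could be small everywhere near radius \<open>Y\<close>. The scale
  \<rho> does not have this defect: it decays at most polynomially in \<open>Y\<close>, while the
  increments of \<psi> between \<open>Y / 2\<close>, \<open>Y\<close> and \<open>2 * Y\<close> beat
  every multiple of \<open>ln Y\<close>. A point isolated at scale \<rho> is isolated at scale
  \<open>r n\<close> as well. For the same reason \<open>Y\<close> itself need not be the balanced
  radius: \<open>L\<close> may contribute any power of it, and the radius must be searched for. As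
  \<open>L\<close> is not known to be continuous, the search walks along a grid and needs a bound on
  the oscillation of \<open>L\<close> over one step. The events are tied to fixed balls instead of
  sample points, because a Poisson sample is independent over disjoint regions and no correlation
  estimate is left to do. Two of them are wanted because a single isolated point may be the whole
  graph, which is then connected. The directions are fixed before \<open>n\<close> grows: their
  balls move apart like \<open>R\<close>, while \<rho> stays below 1.\<close>

section \<open>Regular variation\<close>

text \<open>The mean slopes of \<open>f\<close> over [z/2, z] and [z, 2z] are both asymptotic to
  \<open>f z / z\<close> by regular variation. They are attained by \<open>f'\<close> at points on
  either side of \<open>z\<close>, so a monotone \<open>f'\<close> is squeezed between them at
  \<open>z\<close>.\<close>

lemma monotone_density:
  fixes f f' :: "real \<Rightarrow> real"
  assumes der: "\<And>z. z > 0 \<Longrightarrow> (f has_real_derivative f' z) (at z)"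
    and mono: "mono_on {z0..} f' \<or> antimono_on {z0..} f'"
    and rv: "regularly_varying 1 f"
  shows "\<forall>\<^sub>F z in at_top. f z / (2 * z) \<le> f' z \<and> f' z \<le> 2 * f z / z"
proof -
  have pos: "\<forall>\<^sub>F z in at_top. f z > 0"
    using rv unfolding regularly_varying_def by auto
  have lim: "((\<lambda>R. f (t * R) / f R) \<longlongrightarrow> t) at_top" if "t > 0" for t
    using rv that unfolding regularly_varying_def by auto
  \<comment> \<open>The windows around the limits 2 and 1/2 are chosen so that both mean slopes land
    between \<open>f z / (2 * z)\<close> and \<open>2 * f z / z\<close>.\<close>
  have e2: "\<forall>\<^sub>F z in at_top. f (2 * z) / f z < 3 \<and> f (2 * z) / f z > 3/2"
    using order_tendstoD[OF lim[of 2], of 3] order_tendstoD[OF lim[of 2], of "3/2"]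
    by (auto intro: eventually_conj)
  have e1: "\<forall>\<^sub>F z in at_top. f (1/2 * z) / f z < 3/4 \<and> f (1/2 * z) / f z > 0"
    using order_tendstoD[OF lim[of "1/2"], of "3/4"] order_tendstoD[OF lim[of "1/2"], of 0]
    by (auto intro: eventually_conj)
  show ?thesis
    using pos e1 e2 eventually_gt_at_top[of 0] eventually_ge_at_top[of "2 * z0"] eventually_ge_at_top[of "z0"]
  proof eventually_elim
    case (elim z)
    obtain \<xi> where \<xi>: "z < \<xi>" "f (2 * z) - f z = z * f' \<xi>"
      using MVT2[of z "2 * z" f f'] der elim by auto
    obtain \<eta> where \<eta>: "z/2 < \<eta>" "\<eta> < z" "f z - f (1/2 * z) = z / 2 * f' \<eta>"
      using MVT2[of "z/2" z f f'] der elim by auto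
    have up: "f' \<xi> \<le> 2 * f z / z" "f z / (2 * z) \<le> f' \<xi>"
      using \<xi> elim by (auto simp: field_simps)
    have lo: "f' \<eta> \<le> 2 * f z / z" "f z / (2 * z) \<le> f' \<eta>"
      using \<eta> elim by (auto simp: field_simps)
    from mono show ?case
    proof
      assume m: "mono_on {z0..} f'"
      have "f' z \<le> f' \<xi>" "f' \<eta> \<le> f' z"
        using \<xi> \<eta> elim by (auto intro!: mono_onD[OF m])
      then show ?thesis using up lo by linarith
    next
      assume m: "antimono_on {z0..} f'"
      have "f' \<xi> \<le> f' z" "f' z \<le> f' \<eta>"
        using \<xi> \<eta> elim monotone_onD[OF m, of z \<xi>] monotone_onD[OF m, of \<eta> z] by auto
      then show ?thesis using up lo by linarith
    qed
  qed
qed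

text \<open>The Csiszar--Erdos argument: two subsets of \<open>[0, 3]\<close> of measure greater than
  \<open>3/2\<close> meet.\<close>

lemma uniformly_bounded_increments:
  fixes h :: "real \<Rightarrow> real"
  assumes [measurable]: "h \<in> borel_measurable borel"
    and lim: "\<And>u. ((\<lambda>x. h (x + u) - h x) \<longlongrightarrow> \<alpha> * u) at_top"
  shows "\<exists>c x0. \<forall>x\<ge>x0. \<forall>u\<in>{0..1}. \<bar>h (x + u) - h x\<bar> \<le> c"
proof -
  \<comment> \<open>Subtracting the linear limit reduces the claim to increments that tend to 0
    pointwise.\<close>
  define k where "k = (\<lambda>x. h x - \<alpha> * x)"
  have [measurable]: "k \<in> borel_measurable borel"
    unfolding k_def by measurable
  have klim: "((\<lambda>x. k (x + u) - k x) \<longlongrightarrow> 0) at_top" for u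
    using tendsto_diff[OF lim[of u] tendsto_const[of "\<alpha> * u"]]
    by (simp add: k_def algebra_simps)
  have meas: "{t\<in>{0..2}. \<forall>m\<ge>n. \<bar>k (y m + t) - k (y m)\<bar> \<le> 1} \<in> sets lborel"
    for y :: "nat \<Rightarrow> real" and n
    by measurable
  \<comment> \<open>Pointwise convergence along a sequence exhausts [0, 2] by the increasing sets of
    shifts that are good from \<open>j\<close> on; continuity of measure makes one of them nearly
    full.\<close>
  have big: "\<exists>n. \<forall>j\<ge>n. measure lborel {t\<in>{0..2}. \<forall>m\<ge>j. \<bar>k (y m + t) - k (y m)\<bar> \<le> 1} > 3/2"
    if y: "filterlim y at_top sequentially" for y :: "nat \<Rightarrow> real"
  proof -
    define A where "A = (\<lambda>n::nat. {t\<in>{0..2::real}. \<forall>m\<ge>n. \<bar>k (y m + t) - k (y m)\<bar> \<le> 1})"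
    have inc: "incseq A"
      by (auto simp: incseq_def A_def)
    have un: "(\<Union>n. A n) = {0..2}"
    proof -
      have "\<exists>n. t \<in> A n" if "t \<in> {0..2}" for t
      proof -
        have "((\<lambda>m. k (y m + t) - k (y m)) \<longlongrightarrow> 0) sequentially"
          using filterlim_compose[OF klim y] .
        from tendstoD[OF this, of 1]
        have "\<forall>\<^sub>F m in sequentially. \<bar>k (y m + t) - k (y m)\<bar> \<le> 1"
          by (auto simp: dist_real_def elim!: eventually_mono)
        then obtain n where "\<forall>m\<ge>n. \<bar>k (y m + t) - k (y m)\<bar> \<le> 1"
          unfolding eventually_sequentially by blast
        then have "t \<in> A n" using that unfolding A_def by simp
        then show ?thesis ..
      qed
      moreover have "A n \<subseteq> {0..2}" for n
        by (auto simp: A_def)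
      ultimately show ?thesis by blast
    qed
    have "(\<lambda>n. measure lborel (A n)) \<longlonglongrightarrow> measure lborel (\<Union>n. A n)"
      using meas inc un by (intro Lim_measure_incseq) (auto simp: A_def)
    then have "(\<lambda>n. measure lborel (A n)) \<longlonglongrightarrow> 2"
      unfolding un by simp
    then have "\<forall>\<^sub>F n in sequentially. measure lborel (A n) > 3/2"
      by (rule order_tendstoD) simp
    then show ?thesis
      unfolding A_def eventually_sequentially .
  qed
  have "\<exists>x0. \<forall>x\<ge>x0. \<forall>u\<in>{0..1}. \<bar>k (x + u) - k x\<bar> \<le> 2"
  proof (rule ccontr)
    assume "\<not> ?thesis"
    then have "\<forall>n. \<exists>x u. x \<ge> real n \<and> u \<in> {0..1} \<and> \<bar>k (x + u) - k x\<bar> > 2"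
      by (meson not_le)
    then obtain x u where xu: "\<And>n. x n \<ge> real n" "\<And>n. u n \<in> {0..1}"
        "\<And>n. \<bar>k (x n + u n) - k (x n)\<bar> > 2"
      by metis
    \<comment> \<open>Good shifts are collected from both end points of the bad increment.
      Translating those of \<open>y n\<close> by \<open>u n\<close> measures both families from
      \<open>x n\<close>, inside [0, 3].\<close>
    define y where "y = (\<lambda>n. x n + u n)"
    have x_top: "filterlim x at_top sequentially"
      using xu(1) filterlim_at_top_mono[OF filterlim_real_sequentially] by auto
    have y_ge: "y n \<ge> real n" for n
      using xu(1)[of n] xu(2)[of n] by (auto simp: y_def)
    have y_top: "filterlim y at_top sequentially"
      using y_ge filterlim_at_top_mono[OF filterlim_real_sequentially] by auto
    define A where "A = (\<lambda>n. {t\<in>{0..2::real}. \<forall>m\<ge>n. \<bar>k (x m + t) - k (x m)\<bar> \<le> 1})"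
    define B where "B = (\<lambda>n. {t\<in>{0..2::real}. \<forall>m\<ge>n. \<bar>k (y m + t) - k (y m)\<bar> \<le> 1})"
    obtain n1 where n1: "\<forall>j\<ge>n1. measure lborel (A j) > 3/2"
      using big[OF x_top] unfolding A_def ..
    obtain n2 where n2: "\<forall>j\<ge>n2. measure lborel (B j) > 3/2"
      using big[OF y_top] unfolding B_def ..
    define n where "n = max n1 n2"
    have mA: "A n \<in> sets lborel" and mB: "B n \<in> sets lborel"
      unfolding A_def B_def by (rule meas)+
    let ?B = "(+) (u n) ` B n"
    have "bounded (A n)" "bounded (B n)"
      by (rule bounded_subset[OF bounded_closed_interval[of 0 2]], force simp: A_def B_def)+
    then have B_lmeas: "B n \<in> lmeasurable" "A n \<in> lmeasurable"
      using mA mB by (auto intro!: bounded_set_imp_lmeasurable)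
    have B'_lmeas: "?B \<in> lmeasurable"
      using B_lmeas(1) by (rule measurable_translation)
    have fin: "emeasure lebesgue T \<noteq> \<infinity>" if "T \<in> lmeasurable" for T :: "real set"
      unfolding infinity_ennreal_def using that by (rule fmeasurableD2)
    \<comment> \<open>A common shift would lead to a point at which \<open>k\<close> is within 1 of
      its value at \<open>x n\<close> and at \<open>y n\<close>, bounding the bad increment by
      2.\<close>
    have "A n \<inter> ?B = {}"
    proof (rule ccontr)
      assume "A n \<inter> ?B \<noteq> {}"
      then obtain s where s: "s \<in> B n" "u n + s \<in> A n" by auto
      have "\<bar>k (x n + (u n + s)) - k (x n)\<bar> \<le> 1"
        using s(2) by (auto simp: A_def)
      moreover have "\<bar>k (x n + u n + s) - k (x n + u n)\<bar> \<le> 1"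
        using s(1) by (auto simp: B_def y_def)
      ultimately show False
        using xu(3)[of n] by (simp add: add.assoc abs_if split: if_splits)
    qed
    then have "measure lebesgue (A n \<union> ?B) = measure lebesgue (A n) + measure lebesgue ?B"
      using B_lmeas B'_lmeas by (intro measure_Union fmeasurableD fin)
    also have "\<dots> > 3"
      using n1[rule_format, of n] n2[rule_format, of n] mA mB
      by (simp add: measure_translation n_def)
    finally have "measure lebesgue (A n \<union> ?B) > 3" .
    moreover have "measure lebesgue (A n \<union> ?B) \<le> measure lebesgue {0..3::real}"
    proof (rule measure_mono_fmeasurable)
      have "A n \<subseteq> {0..2}" by (auto simp: A_def)
      moreover have "?B \<subseteq> {0..3}"
        using xu(2)[of n] by (intro subsetI) (fastforce simp: B_def)
      ultimately show "A n \<union> ?B \<subseteq> {0..3}" by fastforce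
      show "A n \<union> ?B \<in> sets lebesgue"
        using B_lmeas B'_lmeas by (intro sets.Un fmeasurableD)
      show "{0..3::real} \<in> lmeasurable" by simp
    qed
    ultimately show False by simp
  qed
  then obtain x0 where x0: "\<And>x u. x \<ge> x0 \<Longrightarrow> u \<in> {0..1} \<Longrightarrow> \<bar>k (x + u) - k x\<bar> \<le> 2"
    by blast
  have "\<bar>h (x + u) - h x\<bar> \<le> 2 + \<bar>\<alpha>\<bar>" if "x \<ge> x0" "u \<in> {0..1}" for x u
  proof -
    have "h (x + u) - h x = (k (x + u) - k x) + \<alpha> * u"
      by (simp add: k_def algebra_simps)
    moreover have "\<bar>\<alpha> * u\<bar> \<le> \<bar>\<alpha>\<bar>"
      using that by (auto simp: abs_mult mult_left_le)
    ultimately show ?thesis using x0[OF that] by linarith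
  qed
  then show ?thesis by blast
qed

text \<open>The point \<open>x\<close> is reached from \<open>x0\<close> in about
  \<open>x - x0\<close> steps of length at most 1. For \<open>h x = ln (L (exp x))\<close> the
  result says that \<open>L\<close> lies between two powers of its argument.\<close>

lemma linear_bound_of_bounded_increments:
  fixes h :: "real \<Rightarrow> real"
  assumes inc: "\<And>x u. x \<ge> x0 \<Longrightarrow> u \<in> {0..1} \<Longrightarrow> \<bar>h (x + u) - h x\<bar> \<le> c"
  shows "\<exists>A. \<forall>\<^sub>F x in at_top. \<bar>h x\<bar> \<le> A * x"
proof -
  have c0: "c \<ge> 0" using inc[of x0 0] by simp
  have step: "\<bar>h x - h x0\<bar> \<le> c * real k" if "x0 \<le> x" "x \<le> x0 + real k" for x k
    using that
  proof (induction k arbitrary: x)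
    case 0
    then show ?case by simp
  next
    case (Suc k)
    show ?case
    proof (cases "x \<le> x0 + 1")
      case True
      then have "\<bar>h x - h x0\<bar> \<le> c" using inc[of x0 "x - x0"] Suc.prems by auto
      also have "c \<le> c * real (Suc k)" using c0 by (simp add: algebra_simps)
      finally show ?thesis .
    next
      case False
      have "\<bar>h (x - 1) - h x0\<bar> \<le> c * real k" using Suc False by auto
      moreover have "\<bar>h x - h (x - 1)\<bar> \<le> c" using inc[of "x - 1" 1] False by auto
      ultimately show ?thesis by (simp add: algebra_simps)
    qed
  qed
  define A where "A = \<bar>h x0\<bar> + c * (\<bar>x0\<bar> + 2)"
  have "\<bar>h x\<bar> \<le> A * x" if "x \<ge> max 1 x0" for x
  proof -
    define k where "k = nat \<lceil>x - x0\<rceil>"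
    have k: "x \<le> x0 + real k" "real k \<le> x - x0 + 1"
      using that unfolding k_def by linarith+
    have "\<bar>h x\<bar> \<le> \<bar>h x0\<bar> + c * real k"
      using step[OF _ k(1)] that by auto
    also have "\<dots> \<le> \<bar>h x0\<bar> * x + c * ((\<bar>x0\<bar> + 2) * x)"
    proof -
      have h: "\<bar>h x0\<bar> * 1 \<le> \<bar>h x0\<bar> * x" using that by (intro mult_left_mono) auto
      have "\<bar>x0\<bar> * 1 \<le> \<bar>x0\<bar> * x" using that by (intro mult_left_mono) auto
      moreover have "1 \<le> x" "- x0 \<le> \<bar>x0\<bar>" using that by auto
      ultimately have "real k \<le> \<bar>x0\<bar> * x + 2 * x" using k(2) by linarith
      then have "real k \<le> (\<bar>x0\<bar> + 2) * x" by (simp add: distrib_right)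
      then have "c * real k \<le> c * ((\<bar>x0\<bar> + 2) * x)" using c0 by (rule mult_left_mono)
      then show ?thesis using h by simp
    qed
    finally show ?thesis by (simp add: A_def algebra_simps)
  qed
  then show ?thesis unfolding eventually_at_top_linorder by blast
qed

text \<open>In logarithmic coordinates the ratios of \<open>L\<close> become increments, with
  \<open>exp 1\<close> matching unit length. Measurability is what upgrades the pointwise limits to
  a bound uniform over the window.\<close>

lemma regularly_varying_slow_variation:
  fixes L :: "real \<Rightarrow> real"
  assumes L_pos: "\<And>z. z > 0 \<Longrightarrow> L z > 0" and rv: "regularly_varying \<alpha> L"
    and meas: "(\<lambda>x. ln (L (exp x))) \<in> borel_measurable borel"
  shows "\<exists>c. \<forall>\<^sub>F s in at_top. \<forall>t\<in>{s..exp 1 * s}. \<bar>ln (L t) - ln (L s)\<bar> \<le> c"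
    and "\<exists>A. \<forall>\<^sub>F z in at_top. \<bar>ln (L z)\<bar> \<le> A * ln z"
proof -
  define h where "h = (\<lambda>x. ln (L (exp x)))"
  have lim: "((\<lambda>x. h (x + u) - h x) \<longlongrightarrow> \<alpha> * u) at_top" for u
  proof -
    have "((\<lambda>R. L (exp u * R) / L R) \<longlongrightarrow> exp u powr \<alpha>) at_top"
      using rv by (simp add: regularly_varying_def)
    from filterlim_compose[OF this exp_at_top]
    have "((\<lambda>x. ln (L (exp u * exp x) / L (exp x))) \<longlongrightarrow> ln (exp u powr \<alpha>)) at_top"
      by (intro tendsto_ln) auto
    moreover have "ln (L (exp u * exp x) / L (exp x)) = h (x + u) - h x" for x
      using L_pos[of "exp x"] L_pos[of "exp u * exp x"]
      by (simp add: h_def ln_div exp_add mult.commute)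
    ultimately show ?thesis by (simp add: ln_powr)
  qed
  obtain c x0 where c: "\<forall>x\<ge>x0. \<forall>u\<in>{0..1}. \<bar>h (x + u) - h x\<bar> \<le> c"
    using uniformly_bounded_increments[OF meas[folded h_def] lim] by blast
  have "\<bar>ln (L t) - ln (L s)\<bar> \<le> c" if s: "s \<ge> exp x0" and t: "t \<in> {s..exp 1 * s}" for s t
  proof -
    have pos: "s > 0" "t > 0" using s t exp_gt_zero[of x0] unfolding atLeastAtMost_iff by linarith+
    have "ln s \<ge> x0" using s pos by (simp add: ln_ge_iff)
    moreover have "ln s \<le> ln t" "ln t \<le> ln (exp 1 * s)" using t pos by auto
    then have "ln t - ln s \<in> {0..1}" using pos by (simp add: ln_mult)
    ultimately have "\<bar>h (ln s + (ln t - ln s)) - h (ln s)\<bar> \<le> c" using c by blast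
    then show ?thesis using pos by (simp add: h_def)
  qed
  then show "\<exists>c. \<forall>\<^sub>F s in at_top. \<forall>t\<in>{s..exp 1 * s}. \<bar>ln (L t) - ln (L s)\<bar> \<le> c"
    unfolding eventually_at_top_linorder by blast
  obtain A where "\<forall>\<^sub>F x in at_top. \<bar>h x\<bar> \<le> A * x"
    using linear_bound_of_bounded_increments[of x0 h c] c by blast
  then have "\<forall>\<^sub>F z in at_top. \<bar>h (ln z)\<bar> \<le> A * ln z"
    using ln_at_top by (rule eventually_compose_filterlim)
  then have "\<forall>\<^sub>F z in at_top. \<bar>ln (L z)\<bar> \<le> A * ln z"
    using eventually_gt_at_top[of 0] by eventually_elim (simp add: h_def)
  then show "\<exists>A. \<forall>\<^sub>F z in at_top. \<bar>ln (L z)\<bar> \<le> A * ln z" ..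
qed

text \<open>By the intermediate value theorem every large \<open>y\<close> is a value of \<psi> at
  some large \<open>z\<close>, and \<phi> has to return that \<open>z\<close>.\<close>

lemma asymptotic_inverse_at_top:
  fixes \<psi> \<phi> :: "real \<Rightarrow> real"
  assumes inv: "asymptotic_inverse \<psi> \<phi>" and cont: "continuous_on {0<..} \<psi>"
    and top: "filterlim \<psi> at_top at_top"
  shows "filterlim \<phi> at_top at_top"
  unfolding filterlim_at_top
proof
  fix Z :: real
  obtain z1 where z1: "\<And>z. z \<ge> z1 \<Longrightarrow> \<phi> (\<psi> z) = z"
    using inv unfolding asymptotic_inverse_def eventually_at_top_linorder by blast
  define a where "a = max 1 (max z1 Z)"
  have "Z \<le> \<phi> y" if y: "y \<ge> \<psi> a" for y
  proof -
    have "\<forall>\<^sub>F z in at_top. \<psi> z \<ge> y \<and> z \<ge> a"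
      using top unfolding filterlim_at_top by (auto intro: eventually_conj eventually_ge_at_top)
    then obtain b where b: "\<psi> b \<ge> y" "b \<ge> a"
      unfolding eventually_at_top_linorder by blast
    have "continuous_on {a..b} \<psi>"
      by (rule continuous_on_subset[OF cont]) (auto simp: a_def)
    with y b obtain z where "a \<le> z" "z \<le> b" "\<psi> z = y"
      using IVT'[of \<psi> a y b] by blast
    then show ?thesis using z1[of z] by (auto simp: a_def)
  qed
  then show "\<forall>\<^sub>F y in at_top. Z \<le> \<phi> y"
    unfolding eventually_at_top_linorder by blast
qed

section \<open>Growth of the exponent and the choice of the radius\<close>

text \<open>The bounds place the logarithmic slope \<open>z * f' z / f z\<close> between 1/2 and 2.
  Hence \<open>f z / z^2\<close> decreases and \<open>(f z)^2 / z\<close> increases, which pins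
  \<open>f\<close> between multiples of the square root and the square; the third power absorbs the
  constant.\<close>

lemma growth_of_log_derivative_bounds:
  fixes f f' :: "real \<Rightarrow> real"
  assumes der: "\<And>z. z > 0 \<Longrightarrow> (f has_real_derivative f' z) (at z)"
    and bounds: "\<forall>\<^sub>F z in at_top. f z / (2 * z) \<le> f' z \<and> f' z \<le> 2 * f z / z"
    and pos: "\<forall>\<^sub>F z in at_top. f z > 0"
  shows "\<forall>\<^sub>F z in at_top. f z \<le> z ^ 3"
    and "\<forall>\<^sub>F z in at_top. B * ln z \<le> f z"
    and "\<exists>z0. mono_on {z0..} f"
proof -
  have "\<forall>\<^sub>F z in at_top. z \<ge> 1 \<and> f z > 0 \<and> f z / (2 * z) \<le> f' z \<and> f' z \<le> 2 * f z / z"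
    using bounds pos eventually_ge_at_top[of 1] by eventually_elim auto
  then obtain z1 where z1: "\<And>z. z \<ge> z1 \<Longrightarrow> z \<ge> 1 \<and> f z > 0 \<and> f z / (2 * z) \<le> f' z \<and> f' z \<le> 2 * f z / z"
    unfolding eventually_at_top_linorder by blast
  have z1_pos: "z1 > 0" "f z1 > 0" using z1[of z1] by auto
  have "mono_on {z1..} f"
  proof (rule mono_onI)
    fix a b assume ab: "a \<in> {z1..}" "b \<in> {z1..}" "a \<le> b"
    show "f a \<le> f b"
    proof (rule DERIV_nonneg_imp_nondecreasing[OF ab(3)])
      fix z assume "a \<le> z" "z \<le> b"
      then have z: "z \<ge> 1" "f z > 0" "f z / (2 * z) \<le> f' z" using z1[of z] ab by auto
      have "0 \<le> f z / (2 * z)" using z by simp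
      then show "\<exists>y. (f has_real_derivative y) (at z) \<and> 0 \<le> y"
        using der[of z] z by (intro exI[of _ "f' z"]) linarith
    qed
  qed
  then show "\<exists>z0. mono_on {z0..} f" by blast
  have upper: "f z \<le> f z1 / z1\<^sup>2 * z\<^sup>2" if "z \<ge> z1" for z
  proof -
    have "f z / z\<^sup>2 \<le> f z1 / z1\<^sup>2"
    proof (rule DERIV_nonpos_imp_nonincreasing[OF that])
      fix y assume "z1 \<le> y" "y \<le> z"
      then have y: "y \<ge> 1" "f y > 0" "f' y \<le> 2 * f y / y" using z1[of y] by auto
      have "((\<lambda>x. f x / x\<^sup>2) has_real_derivative (f' y * y\<^sup>2 - f y * (2 * y)) / (y\<^sup>2 * y\<^sup>2)) (at y)"
        using y by (auto intro!: derivative_eq_intros der)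
      moreover have "f' y * y \<le> 2 * f y" using y by (simp add: field_simps)
      then have "(f' y * y) * y \<le> (2 * f y) * y" using y by (intro mult_right_mono) auto
      then have "(f' y * y\<^sup>2 - f y * (2 * y)) / (y\<^sup>2 * y\<^sup>2) \<le> 0"
        using y by (intro divide_nonpos_nonneg) (simp_all add: power2_eq_square mult_ac)
      ultimately show "\<exists>D. ((\<lambda>x. f x / x\<^sup>2) has_real_derivative D) (at y) \<and> D \<le> 0" by blast
    qed
    then show ?thesis using z1[OF that] by (simp add: field_simps)
  qed
  have lower: "(f z1)\<^sup>2 / z1 * z \<le> (f z)\<^sup>2" if "z \<ge> z1" for z
  proof -
    have "(f z1)\<^sup>2 / z1 \<le> (f z)\<^sup>2 / z"
    proof (rule DERIV_nonneg_imp_nondecreasing[OF that])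
      fix y assume "z1 \<le> y" "y \<le> z"
      then have y: "y \<ge> 1" "f y > 0" "f y / (2 * y) \<le> f' y" using z1[of y] by auto
      have "((\<lambda>x. (f x)\<^sup>2 / x) has_real_derivative (2 * f y * f' y * y - (f y)\<^sup>2) / (y * y)) (at y)"
        using y by (auto intro!: derivative_eq_intros der)
      moreover have "f y \<le> 2 * f' y * y" using y by (simp add: field_simps)
      then have "f y * f y \<le> f y * (2 * f' y * y)" using y by (intro mult_left_mono) auto
      then have "(2 * f y * f' y * y - (f y)\<^sup>2) / (y * y) \<ge> 0"
        by (intro divide_nonneg_nonneg) (auto simp: power2_eq_square algebra_simps)
      ultimately show "\<exists>D. ((\<lambda>x. (f x)\<^sup>2 / x) has_real_derivative D) (at y) \<and> 0 \<le> D" by blast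
    qed
    then show ?thesis using z1[OF that] by (simp add: field_simps)
  qed
  show "\<forall>\<^sub>F z in at_top. f z \<le> z ^ 3"
    using eventually_ge_at_top[of z1] eventually_ge_at_top[of "f z1 / z1\<^sup>2"]
  proof eventually_elim
    case (elim z)
    have "f z \<le> f z1 / z1\<^sup>2 * z\<^sup>2" using upper elim by blast
    also have "\<dots> \<le> z * z\<^sup>2" using elim by (intro mult_right_mono) auto
    finally show ?case by (simp add: power3_eq_cube power2_eq_square)
  qed
  define \<kappa> where "\<kappa> = (f z1)\<^sup>2 / z1"
  have "\<kappa> > 0" using z1_pos by (simp add: \<kappa>_def)
  have "((\<lambda>z::real. (ln z)\<^sup>2 / z) \<longlongrightarrow> 0) at_top" by real_asymp
  from tendsto_mult_right_zero[OF this, of "B\<^sup>2"]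
  have "((\<lambda>z. (B * ln z)\<^sup>2 / z) \<longlongrightarrow> 0) at_top" by (simp add: power_mult_distrib)
  then have "\<forall>\<^sub>F z in at_top. (B * ln z)\<^sup>2 / z < \<kappa>"
    using \<open>\<kappa> > 0\<close> order_tendstoD(2) by blast
  then show "\<forall>\<^sub>F z in at_top. B * ln z \<le> f z"
    using eventually_ge_at_top[of z1]
  proof eventually_elim
    case (elim z)
    have "(B * ln z)\<^sup>2 \<le> \<kappa> * z" using elim(1) z1[OF elim(2)] by (simp add: pos_divide_less_eq)
    also have "\<dots> \<le> (f z)\<^sup>2" using lower elim by (simp add: \<kappa>_def)
    finally have "(B * ln z)\<^sup>2 \<le> (f z)\<^sup>2" .
    moreover have "0 \<le> f z" using z1[of z] elim by auto
    ultimately show ?case by (rule power2_le_imp_le)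
  qed
qed

text \<open>Here \<open>exp (\<psi> Y)\<close> stands for \<open>n\<close>, and the scale depends on
  \<open>Y\<close> only, not on \<open>s\<close>. The logarithm of the product is nonnegative at
  \<open>Y / 2\<close>, negative from \<open>2 * Y\<close> on, and changes by at most
  \<open>D\<close> over distances up to twice the scale. The first negative grid value therefore
  lies in [-D, 0), and its neighbourhood stays in [-2D, D].\<close>

lemma critical_radius:
  fixes \<psi> \<psi>' L :: "real \<Rightarrow> real" and d :: nat
  assumes der: "\<And>z. z > 0 \<Longrightarrow> (\<psi> has_real_derivative \<psi>' z) (at z)"
    and bounds: "\<forall>\<^sub>F z in at_top. \<psi> z / (2 * z) \<le> \<psi>' z \<and> \<psi>' z \<le> 2 * \<psi> z / z"
    and rv: "regularly_varying 1 \<psi>"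
    and L_pos: "\<And>z. z > 0 \<Longrightarrow> L z > 0"
    and L_osc: "\<forall>\<^sub>F s in at_top. \<forall>t\<in>{s..exp 1 * s}. \<bar>ln (L t) - ln (L s)\<bar> \<le> c"
    and L_growth: "\<forall>\<^sub>F z in at_top. \<bar>ln (L z)\<bar> \<le> A * ln z"
    and C0: "C0 > 0"
  shows "\<exists>c1>0. \<exists>c2. \<forall>\<^sub>F Y in at_top. \<exists>R\<ge>Y/2. \<forall>s. \<bar>s - R\<bar> \<le> 2 * min 1 (C0 * Y / \<psi> Y) \<longrightarrow>
           c1 \<le> exp (\<psi> Y) * (L s * exp (- \<psi> s)) * min 1 (C0 * Y / \<psi> Y) ^ d \<and>
           exp (\<psi> Y) * (L s * exp (- \<psi> s)) * min 1 (C0 * Y / \<psi> Y) ^ d \<le> c2"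
proof -
  have pos: "\<forall>\<^sub>F z in at_top. \<psi> z > 0"
    using rv unfolding regularly_varying_def by auto
  have lim: "((\<lambda>R. \<psi> (t * R) / \<psi> R) \<longlongrightarrow> t) at_top" if "t > 0" for t
    using rv that unfolding regularly_varying_def by auto
  \<comment> \<open>At \<open>Y / 2\<close> only a quarter of \<open>\<psi> Y\<close> is left to
    spend. It has to pay \<open>\<bar>A\<bar> * ln Y\<close> for \<open>L\<close> and
    \<open>3 * d * ln Y\<close> for the scale, whose inverse is at most
    \<open>Y ^ 3\<close>.\<close>
  define B where "B = 4 * (\<bar>A\<bar> + 3 * real d + 1)"
  have "\<exists>z0. mono_on {z0..} \<psi>"
    by (rule growth_of_log_derivative_bounds(3)[OF der bounds pos])
  then obtain z0 where mono: "mono_on {z0..} \<psi>" by blast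
  have cubic: "\<forall>\<^sub>F z in at_top. \<psi> z \<le> z ^ 3"
    by (rule growth_of_log_derivative_bounds(1)[OF der bounds pos])
  have log: "\<forall>\<^sub>F z in at_top. B * ln z \<le> \<psi> z"
    by (rule growth_of_log_derivative_bounds(2)[OF der bounds pos])
  have "\<forall>\<^sub>F z in at_top. z \<ge> z0 \<and> z > 2 \<and> \<psi> z > 0 \<and> \<psi>' z \<ge> 0 \<and> \<psi>' z \<le> 2 * \<psi> z / z \<and> B * ln z \<le> \<psi> z
      \<and> \<bar>ln (L z)\<bar> \<le> \<bar>A\<bar> * ln z \<and> (\<forall>t\<in>{z..exp 1 * z}. \<bar>ln (L t) - ln (L z)\<bar> \<le> c)"
    using bounds pos L_growth L_osc log
      eventually_gt_at_top[of 2] eventually_ge_at_top[of z0]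
  proof eventually_elim
    case (elim z)
    have "A * ln z \<le> \<bar>A\<bar> * ln z" using elim by (intro mult_right_mono) auto
    then have "\<bar>ln (L z)\<bar> \<le> \<bar>A\<bar> * ln z" using elim by linarith
    moreover have "0 \<le> \<psi> z / (2 * z)" using elim by simp
    ultimately show ?case using elim by auto
  qed
  then obtain z1 where z1: "\<And>z. z \<ge> z1 \<Longrightarrow> z \<ge> z0 \<and> z > 2 \<and> \<psi> z > 0 \<and> \<psi>' z \<ge> 0 \<and> \<psi>' z \<le> 2 * \<psi> z / z
       \<and> B * ln z \<le> \<psi> z \<and> \<bar>ln (L z)\<bar> \<le> \<bar>A\<bar> * ln z
       \<and> (\<forall>t\<in>{z..exp 1 * z}. \<bar>ln (L t) - ln (L z)\<bar> \<le> c)"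
    unfolding eventually_at_top_linorder by blast
  \<comment> \<open>The oscillation of \<open>ln L\<close> costs \<open>c\<close>. On [Y/4, 4Y] the
    slope of \<psi> is at most \<open>40 * \<psi> Y / Y\<close>, and over a length of at most
    \<open>2 * C0 * Y / \<psi> Y\<close> this adds \<open>80 * C0\<close>.\<close>
  define D where "D = c + 80 * C0"
  have "\<forall>\<^sub>F Y in at_top. \<psi> (4 * Y) / \<psi> Y < 5" "\<forall>\<^sub>F Y in at_top. 3/2 < \<psi> (2 * Y) / \<psi> Y"
      "\<forall>\<^sub>F Y in at_top. \<psi> (1/2 * Y) / \<psi> Y < 3/4"
    using order_tendstoD(2)[OF lim[of 4], of 5] order_tendstoD(1)[OF lim[of 2], of "3/2"]
      order_tendstoD(2)[OF lim[of "1/2"], of "3/4"] by auto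
  then have main: "\<forall>\<^sub>F Y in at_top. \<exists>R\<ge>Y/2. \<forall>s. \<bar>s - R\<bar> \<le> 2 * min 1 (C0 * Y / \<psi> Y) \<longrightarrow>
      exp (- (2 * D)) \<le> exp (\<psi> Y) * (L s * exp (- \<psi> s)) * min 1 (C0 * Y / \<psi> Y) ^ d \<and>
      exp (\<psi> Y) * (L s * exp (- \<psi> s)) * min 1 (C0 * Y / \<psi> Y) ^ d \<le> exp D"
    using cubic
      eventually_ge_at_top[of "4 * z1"] eventually_ge_at_top[of "12"] eventually_ge_at_top[of "z1"]
      eventually_ge_at_top[of "1 / C0"]
  proof eventually_elim
    case (elim Y)
    have \<psi>Y: "\<psi> Y > 0" using z1[of Y] elim by auto
    have Y: "\<psi> (4 * Y) < 5 * \<psi> Y" "3/2 * \<psi> Y < \<psi> (2 * Y)" "\<psi> (Y / 2) < 3/4 * \<psi> Y" "\<psi> Y \<le> Y ^ 3"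
      using elim \<psi>Y by (simp_all add: field_simps)
    define \<rho> where "\<rho> = min 1 (C0 * Y / \<psi> Y)"
    have \<rho>: "0 < \<rho>" "\<rho> \<le> 1" "\<rho> \<le> C0 * Y / \<psi> Y"
      using C0 \<psi>Y elim by (auto simp: \<rho>_def)
    define G where "G = (\<lambda>s. ln (L s) - \<psi> s + \<psi> Y + real d * ln \<rho>)"
    have exp_G: "exp (G s) = exp (\<psi> Y) * (L s * exp (- \<psi> s)) * \<rho> ^ d" if "s > 0" for s
      using L_pos[OF that] \<rho> by (simp add: G_def exp_add exp_diff exp_minus exp_of_nat_mult field_simps)
    have G_osc: "\<bar>G t - G s\<bar> \<le> D" if st: "Y / 4 \<le> s" "s \<le> t" "t \<le> 4 * Y" "t - s \<le> 2 * \<rho>" for s t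
    proof -
      have s: "s \<ge> z1" "s > 2" using st elim z1[of s] by auto
      \<comment> \<open>As \<open>\<rho> \<le> 1\<close>, both points fall into one window of
        \<open>L_osc\<close>.\<close>
      have "s + 2 \<le> 2 * s" using s by simp
      also have "2 * s \<le> exp 1 * s" using s exp_ge_add_one_self[of 1] by (intro mult_right_mono) auto
      finally have "t \<le> exp 1 * s" using st \<rho> by linarith
      then have l: "\<bar>ln (L t) - ln (L s)\<bar> \<le> c" using z1[OF s(1)] st by auto
      have "\<psi> s \<le> \<psi> t" using mono_onD[OF mono, of s t] z1[of s] z1[of t] s st by auto
      moreover have "\<psi> t - \<psi> s \<le> 80 * C0"
      proof (cases "s = t")
        case True
        then show ?thesis using C0 by simp
      next
        case False
        then obtain \<xi> where \<xi>: "s < \<xi>" "\<xi> < t" "\<psi> t - \<psi> s = (t - s) * \<psi>' \<xi>"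
          using MVT2[of s t \<psi> \<psi>'] der s st by auto
        have "\<xi> \<ge> z1" using \<xi> s by simp
        then have "\<psi>' \<xi> \<le> 2 * \<psi> \<xi> / \<xi>" "\<psi>' \<xi> \<ge> 0" "\<psi> \<xi> > 0" using z1[of \<xi>] by auto
        note this(1)
        also have "2 * \<psi> \<xi> / \<xi> \<le> 2 * \<psi> (4 * Y) / (Y / 4)"
          using mono_onD[OF mono, of \<xi> "4 * Y"] z1[of \<xi>] z1[of "4 * Y"] \<open>\<xi> \<ge> z1\<close> \<xi> st elim
          by (intro frac_le) auto
        also have "\<dots> \<le> 2 * (5 * \<psi> Y) / (Y / 4)"
          using Y elim by (intro divide_right_mono) auto
        finally have "\<psi>' \<xi> \<le> 40 * (\<psi> Y / Y)" by simp
        then have "(t - s) * \<psi>' \<xi> \<le> (2 * (C0 * Y / \<psi> Y)) * (40 * (\<psi> Y / Y))"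
          using st \<rho> \<open>\<psi>' \<xi> \<ge> 0\<close> C0 \<psi>Y elim by (intro mult_mono) auto
        also have "\<dots> = 80 * C0" using \<psi>Y elim by (simp add: field_simps)
        finally show ?thesis using \<xi> by simp
      qed
      ultimately show ?thesis using l unfolding G_def D_def by linarith
    qed
    have lnY: "ln Y > 0" using elim by simp
    have "G (Y / 2) \<ge> 0"
    proof -
      have "1 \<le> C0 * Y" using elim C0 by (simp add: field_simps)
      \<comment> \<open>The cubic bound on \<psi> enters here: it keeps \<rho> from shrinking faster
        than a power of \<open>Y\<close>.\<close>
      then have "1 / Y ^ 3 \<le> C0 * Y / \<psi> Y"
        using Y \<psi>Y by (intro frac_le) auto
      moreover have "1 / Y ^ 3 \<le> 1" using elim by (simp add: one_le_power)
      ultimately have "1 / Y ^ 3 \<le> \<rho>" by (simp add: \<rho>_def)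
      then have "ln (1 / Y ^ 3) \<le> ln \<rho>" using elim \<rho> by (subst ln_le_cancel_iff) auto
      then have "- (3 * ln Y) \<le> ln \<rho>" using elim by (simp add: ln_div ln_realpow)
      then have "real d * (- (3 * ln Y)) \<le> real d * ln \<rho>" by (intro mult_left_mono) auto
      moreover have "Y / 2 \<ge> z1" using elim by simp
      then have "\<bar>ln (L (Y / 2))\<bar> \<le> \<bar>A\<bar> * ln (Y / 2)" using z1 by blast
      moreover have "\<bar>A\<bar> * ln (Y / 2) \<le> \<bar>A\<bar> * ln Y" using elim by (intro mult_left_mono) auto
      moreover have "B * ln Y \<le> \<psi> Y" using z1[of Y] elim by auto
      ultimately show ?thesis
        using Y lnY unfolding G_def B_def by (simp add: algebra_simps)
    qed
    \<comment> \<open>Negativity on the whole half-line is needed: the grid need not hit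
      \<open>2 * Y\<close>, and the last nonnegative grid point must lie below it. Since
      \<open>\<psi> Y\<close> is less than two thirds of \<open>\<psi> s\<close>, a third of
      \<open>\<psi> s\<close> remains to pay for \<open>L\<close>.\<close>
    have G_neg: "G s < 0" if "s \<ge> 2 * Y" for s
    proof -
      have s: "s \<ge> z1" "s > 2" using that elim by auto
      have "\<psi> (2 * Y) \<le> \<psi> s"
        using mono_onD[OF mono, of "2 * Y" s] z1[of "2 * Y"] z1[of s] that s elim by auto
      then have "3/2 * \<psi> Y < \<psi> s" using Y by linarith
      moreover have "B * ln s \<le> \<psi> s" "\<bar>ln (L s)\<bar> \<le> \<bar>A\<bar> * ln s" using z1[of s] s by auto
      moreover have "ln s > 0" using s by simp
      then have "real d * ln s \<ge> 0" by simp
      moreover have "real d * ln \<rho> \<le> 0" using \<rho> by (intro mult_nonneg_nonpos) auto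
      moreover have "B * ln s = 4 * (\<bar>A\<bar> * ln s) + 12 * (real d * ln s) + 4 * ln s"
        by (simp add: B_def algebra_simps)
      ultimately show ?thesis
        using \<open>ln s > 0\<close> unfolding G_def by linarith
    qed
    \<comment> \<open>Without continuity of \<open>L\<close> no zero of \<open>G\<close> is
      available; the first sign change along a grid of mesh \<rho> takes its place.\<close>
    define k where "k = (LEAST k. G (Y / 2 + real k * \<rho>) < 0)"
    obtain k0 :: nat where "2 * Y / \<rho> \<le> real k0" using real_arch_simple by blast
    then have "2 * Y \<le> real k0 * \<rho>" using \<rho> by (simp add: field_simps)
    then have "G (Y / 2 + real k0 * \<rho>) < 0" using elim by (intro G_neg) auto
    then have k: "G (Y / 2 + real k * \<rho>) < 0" unfolding k_def by (rule LeastI)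
    have "k \<noteq> 0" using k \<open>G (Y / 2) \<ge> 0\<close> by (intro notI) simp
    then have "k - 1 < k" by simp
    then have "\<not> G (Y / 2 + real (k - 1) * \<rho>) < 0" unfolding k_def by (rule not_less_Least)
    define R where "R = Y / 2 + real k * \<rho>"
    have "R - \<rho> = Y / 2 + real (k - 1) * \<rho>" using \<open>k \<noteq> 0\<close> by (simp add: R_def of_nat_diff algebra_simps)
    then have prev: "G (R - \<rho>) \<ge> 0" using \<open>\<not> G (Y / 2 + real (k - 1) * \<rho>) < 0\<close> by simp
    then have "R - \<rho> < 2 * Y" using G_neg[of "R - \<rho>"] by linarith
    moreover have "0 \<le> real (k - 1) * \<rho>" using \<rho> by simp
    ultimately have R: "R \<ge> Y / 2" "R \<le> 2 * Y + 1" "R - \<rho> \<ge> Y / 2"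
      using \<rho> \<open>R - \<rho> = Y / 2 + real (k - 1) * \<rho>\<close> by linarith+
    have "G R < 0" using k by (simp add: R_def)
    have "G R \<ge> - D" using G_osc[of "R - \<rho>" R] R \<rho> prev elim by auto
    have "exp (- (2 * D)) \<le> exp (\<psi> Y) * (L s * exp (- \<psi> s)) * \<rho> ^ d \<and>
        exp (\<psi> Y) * (L s * exp (- \<psi> s)) * \<rho> ^ d \<le> exp D" if "\<bar>s - R\<bar> \<le> 2 * \<rho>" for s
    proof -
      have s: "Y / 4 \<le> s" "s \<le> 4 * Y" "s > 0" using that R \<rho> elim by linarith+
      have "\<bar>G s - G R\<bar> \<le> D"
      proof (cases "s \<le> R")
        case True
        then show ?thesis using G_osc[of s R] s R that elim by (simp add: abs_minus_commute)
      next
        case False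
        then show ?thesis using G_osc[of R s] s R that elim by simp
      qed
      then show ?thesis
        unfolding exp_G[OF s(3), symmetric] exp_le_cancel_iff using \<open>G R < 0\<close> \<open>G R \<ge> - D\<close> by linarith
    qed
    then show ?case unfolding \<rho>_def using R(1) by blast
  qed
  show ?thesis
    by (intro exI[of _ "exp (- (2 * D))"] exI[of _ "exp D"] conjI main) simp
qed

lemma light_tail_derivative:
  fixes q :: "'a::euclidean_space \<Rightarrow> real"
  assumes "light_tail q \<psi>" "z > 0"
  shows "(\<psi> has_real_derivative deriv \<psi> z) (at z)"
proof -
  have "C2_halfline \<psi>"
    using assms(1) by (simp add: light_tail_def von_mises_def)
  then obtain \<psi>1 where "\<forall>z\<ge>0. (\<psi> has_real_derivative \<psi>1 z) (at z within {0..})"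
    unfolding C2_halfline_def by blast
  then have "(\<psi> has_real_derivative \<psi>1 z) (at z within {0..})"
    using assms(2) by simp
  moreover have "at z within {0..} = at z"
    using assms(2) by (intro at_within_interior) (simp add: interior_real_atLeast)
  ultimately have "(\<psi> has_real_derivative \<psi>1 z) (at z)" by simp
  then show ?thesis by (simp add: DERIV_imp_deriv)
qed

section \<open>Isolated points of a Poisson sample\<close>

lemma poisson_sampleD:
  assumes "poisson_sample c \<nu> M N X"
  shows "prob_space M" "N \<in> measurable M (count_space UNIV)" "X i \<in> borel_measurable M"
    "distr M borel (X i) = \<nu>"
proof -
  show M: "prob_space M" using assms by (simp add: poisson_sample_def)
  have "prob_space.indep_vars M (\<lambda>_. borel) X UNIV" using assms by (simp add: poisson_sample_def)
  then show "X i \<in> borel_measurable M" unfolding prob_space.indep_vars_def2[OF M] by simp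
qed (use assms in \<open>simp_all add: poisson_sample_def\<close>)

lemma poisson_sample_prob_space:
  assumes "poisson_sample c \<nu> M N X"
  shows "prob_space \<nu>" and "sets \<nu> = sets borel" and "space \<nu> = UNIV"
  using prob_space.prob_space_distr[OF poisson_sampleD(1,3)[OF assms]]
  unfolding poisson_sampleD(4)[OF assms, symmetric, of 0] by auto

text \<open>Both independence assumptions on the sample are used here and nowhere later: the
  probabilities below are sums of these cylinders.\<close>

lemma measure_poisson_cylinder:
  assumes ps: "poisson_sample c \<nu> M N X" and S: "\<And>k. S k \<in> sets borel"
  shows "measure M {\<omega>\<in>space M. N \<omega> = m \<and> (\<forall>k<m. X k \<omega> \<in> S k)} =
    pmf (poisson_pmf c) m * (\<Prod>k<m. measure \<nu> (S k))"
proof -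
  interpret prob_space M using ps by (rule poisson_sampleD)
  note [measurable] = poisson_sampleD(2,3)[OF ps]
  have indep: "indep_vars (\<lambda>_. borel) X UNIV"
    using ps by (simp add: poisson_sample_def)
  let ?C = "{f. \<forall>k<m. f k \<in> S k}"
  have C: "?C \<in> sets (Pi\<^sub>M UNIV (\<lambda>_::nat. borel))"
  proof -
    have "{f \<in> space (Pi\<^sub>M UNIV (\<lambda>_::nat. borel)). \<forall>k<m. f k \<in> S k} \<in> sets (Pi\<^sub>M UNIV (\<lambda>_::nat. borel))"
      using S by measurable
    then show ?thesis by (simp add: space_PiM)
  qed
  have "{\<omega>\<in>space M. N \<omega> = m \<and> (\<forall>k<m. X k \<omega> \<in> S k)} =
      (N -` {m} \<inter> space M) \<inter> ((\<lambda>\<omega> i. X i \<omega>) -` ?C \<inter> space M)"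
    by auto
  also have "prob \<dots> = prob (N -` {m} \<inter> space M) * prob ((\<lambda>\<omega> i. X i \<omega>) -` ?C \<inter> space M)"
  proof (rule indep_setD)
    show "indep_set {N -` A \<inter> space M | A. A \<in> sets (count_space UNIV)}
       {(\<lambda>\<omega> i. X i \<omega>) -` B \<inter> space M | B. B \<in> sets (Pi\<^sub>M UNIV (\<lambda>_::nat. borel))}"
      using ps by (simp add: poisson_sample_def)
    show "N -` {m} \<inter> space M \<in> {N -` A \<inter> space M | A. A \<in> sets (count_space UNIV)}"
      by (intro CollectI exI[of _ "{m}"]) simp
    show "(\<lambda>\<omega> i. X i \<omega>) -` ?C \<inter> space M \<in>
        {(\<lambda>\<omega> i. X i \<omega>) -` B \<inter> space M | B. B \<in> sets (Pi\<^sub>M UNIV (\<lambda>_::nat. borel))}"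
      using C by blast
  qed
  also have "prob (N -` {m} \<inter> space M) = pmf (poisson_pmf c) m"
    using measure_distr[OF poisson_sampleD(2)[OF ps], of "{m}"] ps
    by (simp add: poisson_sample_def measure_pmf_single)
  also have "prob ((\<lambda>\<omega> i. X i \<omega>) -` ?C \<inter> space M) = (\<Prod>k<m. measure \<nu> (S k))"
  \<comment> \<open>The product rule for independent variables asks for a nonempty index
    set.\<close>
  proof (cases "m = 0")
    case True
    then show ?thesis by (simp add: prob_space)
  next
    case False
    have "(\<lambda>\<omega> i. X i \<omega>) -` ?C \<inter> space M = (\<Inter>k\<in>{..<m}. X k -` S k \<inter> space M)"
      using False by auto
    also have "prob \<dots> = (\<Prod>k<m. prob (X k -` S k \<inter> space M))"
      using False S by (intro indep_varsD[OF indep]) auto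
    also have "\<dots> = (\<Prod>k<m. measure \<nu> (S k))"
    proof (rule prod.cong)
      fix k
      have "measure (distr M borel (X k)) (S k) = prob (X k -` S k \<inter> space M)"
        using S by (intro measure_distr) auto
      then show "prob (X k -` S k \<inter> space M) = measure \<nu> (S k)"
        by (simp add: poisson_sampleD(4)[OF ps])
    qed simp
    finally show ?thesis .
  qed
  finally show ?thesis .
qed

section \<open>Events that a region holds exactly one point\<close>

text \<open>For \<open>A \<subseteq> B\<close> the index \<open>j\<close> is unique: exactly one
  index falls into \<open>B\<close>, and its point lies in \<open>A\<close>. Indices are counted
  rather than points, so coincident points count separately.\<close>

definition isolated_event ::
  "'w measure \<Rightarrow> ('w \<Rightarrow> nat) \<Rightarrow> (nat \<Rightarrow> 'w \<Rightarrow> 'a) \<Rightarrow> 'a set \<Rightarrow> 'a set \<Rightarrow> 'w set" where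
  "isolated_event M N X A B =
     {\<omega>\<in>space M. \<exists>j<N \<omega>. X j \<omega> \<in> A \<and> (\<forall>k<N \<omega>. k \<noteq> j \<longrightarrow> X k \<omega> \<notin> B)}"

lemma sets_isolated_event:
  assumes ps: "poisson_sample c \<nu> M N X" and [measurable]: "A \<in> sets borel" "B \<in> sets borel"
  shows "isolated_event M N X A B \<in> sets M"
proof -
  note [measurable] = poisson_sampleD(2,3)[OF ps]
  have "Measurable.pred M (\<lambda>\<omega>. (\<lambda>m \<omega>. \<exists>j<m. X j \<omega> \<in> A \<and> (\<forall>k<m. k \<noteq> j \<longrightarrow> X k \<omega> \<notin> B)) (N \<omega>) \<omega>)"
    by (rule measurable_compose_countable) measurable
  then show ?thesis unfolding isolated_event_def by (simp add: pred_def)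
qed

lemma (in prob_space) prob_sums_fibres:
  fixes N :: "'a \<Rightarrow> nat"
  assumes [measurable]: "N \<in> measurable M (count_space UNIV)" and E[measurable]: "E \<in> sets M"
  shows "(\<lambda>m. prob {\<omega>\<in>E. N \<omega> = m}) sums prob E"
proof -
  have "{\<omega>\<in>E. N \<omega> = m} = E \<inter> (N -` {m} \<inter> space M)" for m
    using sets.sets_into_space[OF E] by auto
  then have "{\<omega>\<in>E. N \<omega> = m} \<in> sets M" for m
    by simp
  then have "range (\<lambda>m. {\<omega>\<in>E. N \<omega> = m}) \<subseteq> sets M" by blast
  moreover have "disjoint_family (\<lambda>m. {\<omega>\<in>E. N \<omega> = m})"
    by (auto simp: disjoint_family_on_def)
  moreover have "(\<Union>m. {\<omega>\<in>E. N \<omega> = m}) = E" by auto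
  ultimately show ?thesis
    using finite_measure_UNION[of "\<lambda>m. {\<omega>\<in>E. N \<omega> = m}"] by simp
qed

text \<open>This is the chance that one Poisson variable with mean
  \<open>c * measure \<nu> A\<close> is 1 and an independent one for \<open>B - A\<close> is 0.
  Conditioning on \<open>N\<close> gives it directly: each of the \<open>m\<close> choices of the
  special index contributes \<open>a * (1 - b) ^ (m - 1)\<close>.\<close>

lemma prob_isolated_event:
  assumes ps: "poisson_sample c \<nu> M N X" and c: "c > 0"
    and A: "A \<in> sets borel" and B: "B \<in> sets borel" and AB: "A \<subseteq> B"
  shows "measure M (isolated_event M N X A B) = c * measure \<nu> A * exp (- c * measure \<nu> B)"
proof -
  interpret prob_space M using ps by (rule poisson_sampleD)
  interpret \<nu>: prob_space \<nu> using ps by (rule poisson_sample_prob_space)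
  note [measurable] = poisson_sampleD(2,3)[OF ps] A B
  define a b where "a = measure \<nu> A" and "b = measure \<nu> B"
  let ?E = "isolated_event M N X A B"
  define S where "S = (\<lambda>j k::nat. if k = j then A else - B)"
  have S[measurable]: "S j k \<in> sets borel" for j k
    using A B by (simp add: S_def)
  define F where "F = (\<lambda>m j. {\<omega>\<in>space M. N \<omega> = m \<and> (\<forall>k<m. X k \<omega> \<in> S j k)})"
  have F[measurable]: "F m j \<in> sets M" for m j
    unfolding F_def by measurable
  have \<nu>S: "measure \<nu> (S j k) = (if k = j then a else 1 - b)" for j k
    using \<nu>.prob_compl[of B] B poisson_sample_prob_space[OF ps]
    by (simp add: S_def a_def b_def Compl_eq_Diff_UNIV)
  have "prob {\<omega>\<in>?E. N \<omega> = m} = real m * (pmf (poisson_pmf c) m * (a * (1 - b) ^ (m - 1)))" for m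
  proof -
    have "{\<omega>\<in>?E. N \<omega> = m} = (\<Union>j\<in>{..<m}. F m j)"
      unfolding isolated_event_def F_def S_def by auto
    also have "prob \<dots> = (\<Sum>j<m. prob (F m j))"
    proof (rule finite_measure_finite_Union)
      show "disjoint_family_on (F m) {..<m}"
        using AB unfolding disjoint_family_on_def F_def S_def by fastforce
    qed auto
    also have "\<dots> = (\<Sum>j<m. pmf (poisson_pmf c) m * (a * (1 - b) ^ (m - 1)))"
    proof (rule sum.cong)
      fix j assume j: "j \<in> {..<m}"
      have "prob (F m j) = pmf (poisson_pmf c) m * (\<Prod>k<m. measure \<nu> (S j k))"
        unfolding F_def using S by (rule measure_poisson_cylinder[OF ps])
      also have "(\<Prod>k<m. measure \<nu> (S j k)) = a * (\<Prod>k\<in>{..<m} - {j}. measure \<nu> (S j k))"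
        using j by (simp add: prod.remove[of _ j] \<nu>S)
      also have "(\<Prod>k\<in>{..<m} - {j}. measure \<nu> (S j k)) = (\<Prod>k\<in>{..<m} - {j}. 1 - b)"
        by (intro prod.cong) (auto simp: \<nu>S)
      also have "\<dots> = (1 - b) ^ (m - 1)" using j by simp
      finally show "prob (F m j) = pmf (poisson_pmf c) m * (a * (1 - b) ^ (m - 1))" .
    qed simp
    finally show ?thesis by simp
  qed
  moreover have "?E \<in> sets M" using ps A B by (rule sets_isolated_event)
  ultimately have sums: "(\<lambda>m. real m * (pmf (poisson_pmf c) m * (a * (1 - b) ^ (m - 1)))) sums prob ?E"
    using prob_sums_fibres[of N ?E] by simp
  \<comment> \<open>The term for \<open>m = 0\<close> vanishes and the factor \<open>m\<close>
    cancels against the factorial, leaving an exponential series shifted by one.\<close>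
  have "(\<lambda>n. (c * a * exp (- c)) * ((c * (1 - b)) ^ n /\<^sub>R fact n)) sums ((c * a * exp (- c)) * exp (c * (1 - b)))"
    by (intro sums_mult exp_converges)
  moreover have "(c * a * exp (- c)) * ((c * (1 - b)) ^ n /\<^sub>R fact n) =
      real (Suc n) * (pmf (poisson_pmf c) (Suc n) * (a * (1 - b) ^ (Suc n - 1)))" for n
    using c by (simp add: power_mult_distrib divide_simps del: of_nat_Suc)
  ultimately have "(\<lambda>n. real (Suc n) * (pmf (poisson_pmf c) (Suc n) * (a * (1 - b) ^ (Suc n - 1)))) sums
      ((c * a * exp (- c)) * exp (c * (1 - b)))"
    by (simp only:)
  from sums_Suc[OF this]
  have "(\<lambda>m. real m * (pmf (poisson_pmf c) m * (a * (1 - b) ^ (m - 1)))) sums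
      ((c * a * exp (- c)) * exp (c * (1 - b)))" by simp
  with sums have "prob ?E = (c * a * exp (- c)) * exp (c * (1 - b))"
    by (rule sums_unique2)
  also have "\<dots> = c * a * exp (- c * b)"
    by (simp add: exp_add[symmetric] algebra_simps)
  finally show ?thesis by (simp add: a_def b_def)
qed

text \<open>Given \<open>N = m\<close> the indices compete for the two regions and the events are
  dependent; only the Poisson mixture over \<open>m\<close> factorises, because the exponential of
  the summed masses splits.\<close>

lemma prob_isolated_event_Int:
  assumes ps: "poisson_sample c \<nu> M N X" and c: "c > 0"
    and A: "A1 \<in> sets borel" "A2 \<in> sets borel" and B: "B1 \<in> sets borel" "B2 \<in> sets borel"
    and AB: "A1 \<subseteq> B1" "A2 \<subseteq> B2" and disj: "B1 \<inter> B2 = {}"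
  shows "measure M (isolated_event M N X A1 B1 \<inter> isolated_event M N X A2 B2) =
    measure M (isolated_event M N X A1 B1) * measure M (isolated_event M N X A2 B2)"
proof -
  interpret prob_space M using ps by (rule poisson_sampleD)
  interpret \<nu>: prob_space \<nu> using ps by (rule poisson_sample_prob_space)
  note [measurable] = poisson_sampleD(2,3)[OF ps] A B
  define a1 a2 b where "a1 = measure \<nu> A1" and "a2 = measure \<nu> A2"
    and "b = measure \<nu> B1 + measure \<nu> B2"
  let ?E = "isolated_event M N X A1 B1 \<inter> isolated_event M N X A2 B2"
  define S where "S = (\<lambda>i j k::nat. if k = i then A1 else if k = j then A2 else - (B1 \<union> B2))"
  have S[measurable]: "S i j k \<in> sets borel" for i j k
    using A B by (auto simp: S_def)
  define F where "F = (\<lambda>m (i, j). {\<omega>\<in>space M. N \<omega> = m \<and> (\<forall>k<m. X k \<omega> \<in> S i j k)})"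
  have F[measurable]: "F m ij \<in> sets M" for m ij
    unfolding F_def by (cases ij) simp
  have \<nu>S: "measure \<nu> (S i j k) = (if k = i then a1 else if k = j then a2 else 1 - b)" for i j k
    using \<nu>.prob_compl[of "B1 \<union> B2"] B poisson_sample_prob_space[OF ps] disj
    by (simp add: S_def a1_def a2_def b_def Compl_eq_Diff_UNIV \<nu>.finite_measure_Union)
  have "prob {\<omega>\<in>?E. N \<omega> = m} =
      real m * real (m - 1) * (pmf (poisson_pmf c) m * (a1 * a2 * (1 - b) ^ (m - 2)))" for m
  proof -
    \<comment> \<open>Ordered pairs of distinct indices; their number \<open>m * (m - 1)\<close> is
      0 for \<open>m = 0\<close> and \<open>m = 1\<close>, so the truncated subtraction does no harm
      and the series shifts by two.\<close>
    let ?I = "SIGMA i:{..<m}. {..<m} - {i}"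
    have "{\<omega>\<in>?E. N \<omega> = m} = (\<Union>ij\<in>?I. F m ij)"
    proof (intro equalityI subsetI)
      fix \<omega> assume "\<omega> \<in> {\<omega>\<in>?E. N \<omega> = m}"
      then obtain i j where "\<omega> \<in> space M" "N \<omega> = m"
          "i < m" "X i \<omega> \<in> A1" "\<forall>k<m. k \<noteq> i \<longrightarrow> X k \<omega> \<notin> B1"
          "j < m" "X j \<omega> \<in> A2" "\<forall>k<m. k \<noteq> j \<longrightarrow> X k \<omega> \<notin> B2"
        unfolding isolated_event_def by auto
      moreover from this have "i \<noteq> j" using AB disj by auto
      ultimately have "(i, j) \<in> ?I" "\<omega> \<in> F m (i, j)"
        by (auto simp: F_def S_def)
      then show "\<omega> \<in> (\<Union>ij\<in>?I. F m ij)" by blast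
    next
      fix \<omega> assume "\<omega> \<in> (\<Union>ij\<in>?I. F m ij)"
      then obtain i j where ij: "i < m" "j < m" "i \<noteq> j" "\<omega> \<in> space M" "N \<omega> = m"
          "\<And>k. k < m \<Longrightarrow> X k \<omega> \<in> S i j k"
        unfolding F_def by auto
      have i: "X i \<omega> \<in> A1" and j: "X j \<omega> \<in> A2"
        using ij(6)[of i] ij(6)[of j] ij(1-3) by (auto simp: S_def)
      have "X k \<omega> \<notin> B1" if "k < m" "k \<noteq> i" for k
        using ij(6)[OF that(1)] that j AB disj by (auto simp: S_def split: if_splits)
      moreover have "X k \<omega> \<notin> B2" if "k < m" "k \<noteq> j" for k
        using ij(6)[OF that(1)] that i AB disj by (auto simp: S_def split: if_splits)
      ultimately show "\<omega> \<in> {\<omega>\<in>?E. N \<omega> = m}"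
        using ij(1-5) i j unfolding isolated_event_def by blast
    qed
    also have "prob \<dots> = (\<Sum>ij\<in>?I. prob (F m ij))"
    proof (rule finite_measure_finite_Union)
      have "i = i' \<and> j = j'" if "i < m" "j < m" "i \<noteq> j" "i' < m" "j' < m" "i' \<noteq> j'"
          "\<omega> \<in> F m (i, j)" "\<omega> \<in> F m (i', j')" for i j i' j' \<omega>
      proof -
        have *: "X i \<omega> \<in> A1" "X j \<omega> \<in> A2" "X i \<omega> \<in> S i' j' i" "X j \<omega> \<in> S i' j' j"
          using that by (auto simp: F_def S_def)
        then show ?thesis using AB disj by (auto simp: S_def split: if_splits)
      qed
      then show "disjoint_family_on (F m) ?I"
        unfolding disjoint_family_on_def by fast
    qed auto
    also have "\<dots> = (\<Sum>ij\<in>?I. pmf (poisson_pmf c) m * (a1 * a2 * (1 - b) ^ (m - 2)))"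
    proof (rule sum.cong)
      fix ij assume "ij \<in> ?I"
      then obtain i j where ij: "ij = (i, j)" "i < m" "j < m" "i \<noteq> j" by auto
      have "prob (F m ij) = pmf (poisson_pmf c) m * (\<Prod>k<m. measure \<nu> (S i j k))"
        unfolding F_def ij(1) prod.case using S by (rule measure_poisson_cylinder[OF ps])
      also have "(\<Prod>k<m. measure \<nu> (S i j k)) = a1 * (\<Prod>k\<in>{..<m} - {i}. measure \<nu> (S i j k))"
        using ij by (simp add: prod.remove[of _ i] \<nu>S)
      also have "(\<Prod>k\<in>{..<m} - {i}. measure \<nu> (S i j k)) =
          a2 * (\<Prod>k\<in>{..<m} - {i} - {j}. measure \<nu> (S i j k))"
        using ij by (subst prod.remove[of _ j]) (auto simp: \<nu>S)
      also have "(\<Prod>k\<in>{..<m} - {i} - {j}. measure \<nu> (S i j k)) = (\<Prod>k\<in>{..<m} - {i} - {j}. 1 - b)"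
        by (intro prod.cong) (auto simp: \<nu>S)
      also have "\<dots> = (1 - b) ^ (m - 2)" using ij by (simp add: numeral_2_eq_2)
      finally show "prob (F m ij) = pmf (poisson_pmf c) m * (a1 * a2 * (1 - b) ^ (m - 2))" by simp
    qed simp
    also have "\<dots> = real (card ?I) * (pmf (poisson_pmf c) m * (a1 * a2 * (1 - b) ^ (m - 2)))"
      by simp
    also have "card ?I = m * (m - 1)" by simp
    finally show ?thesis by simp
  qed
  moreover have "?E \<in> sets M" using sets_isolated_event[OF ps] A B by auto
  ultimately have sums: "(\<lambda>m. real m * real (m - 1) * (pmf (poisson_pmf c) m * (a1 * a2 * (1 - b) ^ (m - 2))))
      sums prob ?E"
    using prob_sums_fibres[of N ?E] by simp
  have "(\<lambda>n. (c\<^sup>2 * a1 * a2 * exp (- c)) * ((c * (1 - b)) ^ n /\<^sub>R fact n)) sums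
      ((c\<^sup>2 * a1 * a2 * exp (- c)) * exp (c * (1 - b)))"
    by (intro sums_mult exp_converges)
  moreover have "(c\<^sup>2 * a1 * a2 * exp (- c)) * ((c * (1 - b)) ^ n /\<^sub>R fact n) =
      real (Suc (Suc n)) * real (Suc (Suc n) - 1) *
        (pmf (poisson_pmf c) (Suc (Suc n)) * (a1 * a2 * (1 - b) ^ (Suc (Suc n) - 2)))" for n
    using c by (simp add: power_mult_distrib divide_simps power2_eq_square del: of_nat_Suc)
  ultimately have "(\<lambda>n. real (Suc (Suc n)) * real (Suc (Suc n) - 1) *
        (pmf (poisson_pmf c) (Suc (Suc n)) * (a1 * a2 * (1 - b) ^ (Suc (Suc n) - 2)))) sums
      ((c\<^sup>2 * a1 * a2 * exp (- c)) * exp (c * (1 - b)))"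
    by (simp only:)
  from sums_Suc[OF sums_Suc[OF this]]
  have "(\<lambda>m. real m * real (m - 1) * (pmf (poisson_pmf c) m * (a1 * a2 * (1 - b) ^ (m - 2)))) sums
      ((c\<^sup>2 * a1 * a2 * exp (- c)) * exp (c * (1 - b)))" by simp
  with sums have "prob ?E = (c\<^sup>2 * a1 * a2 * exp (- c)) * exp (c * (1 - b))"
    by (rule sums_unique2)
  also have "\<dots> = (c * a1 * exp (- c * measure \<nu> B1)) * (c * a2 * exp (- c * measure \<nu> B2))"
    by (simp add: b_def power2_eq_square exp_add[symmetric] algebra_simps)
  finally show ?thesis
    using prob_isolated_event[OF ps c A(1) B(1) AB(1)] prob_isolated_event[OF ps c A(2) B(2) AB(2)]
    by (simp add: a1_def a2_def)
qed

section \<open>A second-moment bound\<close>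

text \<open>For the number \<open>W\<close> of events that occur, pairwise independence bounds the
  variance by the mean \<open>s\<close>. At most one occurrence means a deviation of at least
  \<open>s - 1\<close>, to which Chebyshev's inequality applies.\<close>

lemma (in prob_space) two_of_pairwise_independent_events:
  assumes E: "\<And>i. i < K \<Longrightarrow> E i \<in> events"
    and indep: "\<And>i j. i < K \<Longrightarrow> j < K \<Longrightarrow> i \<noteq> j \<Longrightarrow> prob (E i \<inter> E j) = prob (E i) * prob (E j)"
    and p: "\<And>i. i < K \<Longrightarrow> p \<le> prob (E i)" and K: "2 \<le> real K * p"
  shows "1 - 4 / (real K * p) \<le> prob {\<omega>\<in>space M. \<exists>i<K. \<exists>j<K. i \<noteq> j \<and> \<omega> \<in> E i \<and> \<omega> \<in> E j}"
proof -
  define W where "W = (\<lambda>\<omega>. \<Sum>i<K. indicator (E i) \<omega> :: real)"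
  define s where "s = (\<Sum>i<K. prob (E i))"
  have [measurable]: "E i \<in> events" if "i \<in> {..<K}" for i using E that by simp
  have "real K * p = (\<Sum>i<K. p)" by simp
  also have "\<dots> \<le> s" unfolding s_def by (intro sum_mono p) simp
  finally have s: "real K * p \<le> s" .
  have W_meas[measurable]: "W \<in> borel_measurable M"
    unfolding W_def by measurable
  have EW: "expectation W = s"
    unfolding W_def s_def using E
    by (subst Bochner_Integration.integral_sum) (auto simp: less_top[symmetric])
  have W2: "(W \<omega>)\<^sup>2 = (\<Sum>i<K. \<Sum>j<K. indicator (E i \<inter> E j) \<omega>)" for \<omega>
    unfolding W_def power2_eq_square sum_product by (simp add: indicator_inter_arith)
  have int: "integrable M (\<lambda>\<omega>. indicator (E i \<inter> E j) \<omega> :: real)" if "i < K" "j < K" for i j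
    using E that by (intro integrable_real_indicator sets.Int) (auto simp: less_top[symmetric])
  have int2: "integrable M (\<lambda>\<omega>. (W \<omega>)\<^sup>2)"
    unfolding W2 using int by (auto intro!: Bochner_Integration.integrable_sum)
  have "expectation (\<lambda>\<omega>. (W \<omega>)\<^sup>2) =
      (\<Sum>i<K. expectation (\<lambda>\<omega>. \<Sum>j<K. indicator (E i \<inter> E j) \<omega>))"
    unfolding W2 using int
    by (intro Bochner_Integration.integral_sum Bochner_Integration.integrable_sum) auto
  also have "\<dots> = (\<Sum>i<K. \<Sum>j<K. expectation (indicator (E i \<inter> E j)))"
    using int by (intro sum.cong refl Bochner_Integration.integral_sum) auto
  also have "\<dots> = (\<Sum>i<K. \<Sum>j<K. prob (E i \<inter> E j))"
    using E by (intro sum.cong refl) (simp add: sets.Int)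
  \<comment> \<open>Off the diagonal this is pairwise independence; on it, the event's own
    probability is an upper bound.\<close>
  also have "\<dots> \<le> (\<Sum>i<K. \<Sum>j<K. prob (E i) * prob (E j) + (if i = j then prob (E i) else 0))"
    using indep by (intro sum_mono) auto
  also have "\<dots> = s\<^sup>2 + s"
    by (simp add: sum.distrib s_def power2_eq_square sum_product)
  finally have "variance W \<le> s"
    using int2 W_meas EW by (subst variance_eq) (auto intro: square_integrable_imp_integrable)
  have "prob {\<omega>\<in>space M. s - 1 \<le> \<bar>W \<omega> - s\<bar>} \<le> variance W / (s - 1)\<^sup>2"
    using Chebyshev_inequality[OF W_meas int2, of "s - 1"] K s EW by simp
  also have "\<dots> \<le> s / (s - 1)\<^sup>2"
    using \<open>variance W \<le> s\<close> by (intro divide_right_mono) auto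
  also have "\<dots> \<le> 4 / s"
  proof -
    \<comment> \<open>From \<open>s \<ge> 2\<close> follows \<open>s \<le> 2 * (s - 1)\<close>, the
      source of the constant 4.\<close>
    have "s * s \<le> (2 * (s - 1)) * (2 * (s - 1))" using K s by (intro mult_mono) auto
    then show ?thesis using K s by (simp add: field_simps power2_eq_square)
  qed
  also have "\<dots> \<le> 4 / (real K * p)" using K s by (intro divide_left_mono) auto
  finally have "prob {\<omega>\<in>space M. s - 1 \<le> \<bar>W \<omega> - s\<bar>} \<le> 4 / (real K * p)" .
  moreover have "prob (space M - {\<omega>\<in>space M. s - 1 \<le> \<bar>W \<omega> - s\<bar>}) =
      1 - prob {\<omega>\<in>space M. s - 1 \<le> \<bar>W \<omega> - s\<bar>}"
    by (intro prob_compl) measurable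
  moreover have "prob (space M - {\<omega>\<in>space M. s - 1 \<le> \<bar>W \<omega> - s\<bar>}) \<le>
      prob {\<omega>\<in>space M. \<exists>i<K. \<exists>j<K. i \<noteq> j \<and> \<omega> \<in> E i \<and> \<omega> \<in> E j}"
  proof (rule finite_measure_mono)
    have "{\<omega>\<in>space M. \<exists>i\<in>{..<K}. \<exists>j\<in>{..<K}. i \<noteq> j \<and> \<omega> \<in> E i \<and> \<omega> \<in> E j} \<in> events"
      by measurable
    then show "{\<omega>\<in>space M. \<exists>i<K. \<exists>j<K. i \<noteq> j \<and> \<omega> \<in> E i \<and> \<omega> \<in> E j} \<in> events"
      by (simp add: Bex_def)
  next
    show "space M - {\<omega>\<in>space M. s - 1 \<le> \<bar>W \<omega> - s\<bar>} \<subseteq>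
        {\<omega>\<in>space M. \<exists>i<K. \<exists>j<K. i \<noteq> j \<and> \<omega> \<in> E i \<and> \<omega> \<in> E j}"
    proof
      fix \<omega> assume \<omega>: "\<omega> \<in> space M - {\<omega>\<in>space M. s - 1 \<le> \<bar>W \<omega> - s\<bar>}"
      then have "W \<omega> > 1" by (auto simp: not_le abs_less_iff)
      moreover have "W \<omega> = real (card {i\<in>{..<K}. \<omega> \<in> E i})"
        unfolding W_def indicator_def by (simp add: sum.If_cases Int_def)
      ultimately have "\<not> card {i\<in>{..<K}. \<omega> \<in> E i} \<le> Suc 0" by simp
      then show "\<omega> \<in> {\<omega>\<in>space M. \<exists>i<K. \<exists>j<K. i \<noteq> j \<and> \<omega> \<in> E i \<and> \<omega> \<in> E j}"
        using \<omega> by (auto simp: card_le_Suc0_iff_eq)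
    qed
  qed
  ultimately show ?thesis by linarith
qed

section \<open>Cuts of the geometric graph\<close>

text \<open>Cuts avoid walks: one isolated point is already a cut, and cuts can be read off from
  index sets. The empty vertex set is a separate case because it has no proper cut although it
  counts as disconnected.\<close>

lemma disconnected_geometric_graph_iff:
  fixes P :: "'a::metric_space set"
  shows "disconnected_graph (geometric_graph P \<rho>) \<longleftrightarrow>
    P = {} \<or> (\<exists>S\<subseteq>P. S \<noteq> {} \<and> S \<noteq> P \<and> (\<forall>x\<in>S. \<forall>y\<in>P - S. dist x y \<ge> \<rho>))"
proof -
  let ?G = "geometric_graph P \<rho>"
  define E where "E = {(x, y). x \<in> P \<and> y \<in> P \<and> x \<noteq> y \<and> dist x y < \<rho>}"
  have arcs: "arcs_ends (with_proj (mk_symmetric (with_proj ?G))) = E"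
    by (auto simp: arcs_ends_conv parcs_mk_symmetric geometric_graph_def E_def dist_commute image_iff)
  have verts: "pverts ?G = P"
    by (simp add: geometric_graph_def)
  have disc: "disconnected_graph ?G \<longleftrightarrow> P = {} \<or> (\<exists>u\<in>P. \<exists>v\<in>P. (u, v) \<notin> rtrancl_on P E)"
    unfolding disconnected_graph_def connected_def strongly_connected_def reachable_def arcs
    by (auto simp: verts)
  have "(\<exists>u\<in>P. \<exists>v\<in>P. (u, v) \<notin> rtrancl_on P E) \<longleftrightarrow>
      (\<exists>S\<subseteq>P. S \<noteq> {} \<and> S \<noteq> P \<and> (\<forall>x\<in>S. \<forall>y\<in>P - S. dist x y \<ge> \<rho>))" (is "?l \<longleftrightarrow> ?r")
  proof
    assume ?l
    then obtain u v where uv: "u \<in> P" "v \<in> P" "(u, v) \<notin> rtrancl_on P E" by blast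
    \<comment> \<open>The component of \<open>u\<close>; an edge leaving it would enlarge
      it.\<close>
    define S where "S = {w\<in>P. (u, w) \<in> rtrancl_on P E}"
    have "dist x y \<ge> \<rho>" if "x \<in> S" "y \<in> P - S" for x y
    proof (rule ccontr)
      assume "\<not> dist x y \<ge> \<rho>"
      then have "(x, y) \<in> E" using that by (auto simp: E_def S_def)
      then have "(u, y) \<in> rtrancl_on P E"
        using that rtrancl_on_into_rtrancl_on[of u x P E y] by (auto simp: S_def)
      then show False using that by (auto simp: S_def)
    qed
    moreover have "u \<in> S" "v \<notin> S" using uv by (auto simp: S_def)
    moreover have "S \<subseteq> P" by (auto simp: S_def)
    ultimately show ?r using uv by blast
  next
    assume ?r
    then obtain S where S: "S \<subseteq> P" "S \<noteq> {}" "S \<noteq> P" "\<forall>x\<in>S. \<forall>y\<in>P - S. dist x y \<ge> \<rho>" by blast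
    then obtain u v where uv: "u \<in> S" "v \<in> P - S" by blast
    have "w \<in> S" if "(u, w) \<in> rtrancl_on P E" for w
      using that
    proof (induction rule: rtrancl_on_induct)
      case base
      then show ?case using uv by simp
    next
      case (step x y)
      then show ?case using S(4) unfolding E_def by (auto simp: not_le[symmetric])
    qed
    then show ?l using uv S by blast
  qed
  then show ?thesis using disc by simp
qed

text \<open>Different indices may carry the same point, but \<open>\<rho> > 0\<close> forces them
  onto the same side of a cut. Hence cuts of points and of indices correspond.\<close>

lemma disconnected_poisson_points_iff:
  assumes "\<rho> > 0"
  shows "disconnected_graph (geometric_graph (poisson_points N X \<omega>) \<rho>) \<longleftrightarrow>
    N \<omega> = 0 \<or> (\<exists>S\<subseteq>{..<N \<omega>}. S \<noteq> {} \<and> S \<noteq> {..<N \<omega>} \<and>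
      (\<forall>i\<in>S. \<forall>j\<in>{..<N \<omega>} - S. dist (X i \<omega>) (X j \<omega>) \<ge> \<rho>))" (is "_ \<longleftrightarrow> _ \<or> ?r")
proof -
  let ?I = "{..<N \<omega>}" and ?f = "\<lambda>i. X i \<omega>"
  have "(\<exists>T\<subseteq>?f ` ?I. T \<noteq> {} \<and> T \<noteq> ?f ` ?I \<and> (\<forall>x\<in>T. \<forall>y\<in>?f ` ?I - T. dist x y \<ge> \<rho>)) \<longleftrightarrow> ?r" (is "?l \<longleftrightarrow> _")
  proof
    assume ?l
    then obtain T where T: "T \<subseteq> ?f ` ?I" "T \<noteq> {}" "T \<noteq> ?f ` ?I" "\<forall>x\<in>T. \<forall>y\<in>?f ` ?I - T. dist x y \<ge> \<rho>" by blast
    then show ?r by (intro exI[of _ "{i\<in>?I. ?f i \<in> T}"]) blast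
  next
    assume ?r
    then obtain S where S: "S \<subseteq> ?I" "S \<noteq> {}" "S \<noteq> ?I" "\<forall>i\<in>S. \<forall>j\<in>?I - S. dist (?f i) (?f j) \<ge> \<rho>" by blast
    have sep: "?f j \<notin> ?f ` S" if "j \<in> ?I - S" for j
    proof
      assume "?f j \<in> ?f ` S"
      then obtain i where "i \<in> S" "?f j = ?f i" by auto
      moreover from this have "dist (?f i) (?f j) \<ge> \<rho>" using S(4) that by blast
      ultimately show False using assms by simp
    qed
    then show ?l using S by (intro exI[of _ "?f ` S"]) blast
  qed
  then show ?thesis
    unfolding disconnected_geometric_graph_iff poisson_points_def by auto
qed

text \<open>For a fixed number of points the index form is a finite combination of conditions on
  distances; the random number of points is then handled by countability.\<close>

lemma sets_disconnected_poisson_graph: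
  fixes X :: "nat \<Rightarrow> 'w \<Rightarrow> 'a::euclidean_space"
  assumes ps: "poisson_sample c \<nu> M N X" and r: "r > 0"
  shows "{\<omega>\<in>space M. disconnected_graph (geometric_graph (poisson_points N X \<omega>) r)} \<in> sets M"
proof -
  note [measurable] = poisson_sampleD(2,3)[OF ps]
  define P where "P = (\<lambda>m \<omega>. m = 0 \<or> (\<exists>S\<in>Pow {..<m}. S \<noteq> {} \<and> S \<noteq> {..<m} \<and>
      (\<forall>i. i \<in> S \<longrightarrow> (\<forall>j. j \<in> {..<m} - S \<longrightarrow> r \<le> dist (X i \<omega>) (X j \<omega>)))))"
  have "Measurable.pred M (P m)" for m
    unfolding P_def by measurable
  then have "Measurable.pred M (\<lambda>\<omega>. P (N \<omega>) \<omega>)"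
    by (rule measurable_compose_countable) measurable
  moreover have "disconnected_graph (geometric_graph (poisson_points N X \<omega>) r) \<longleftrightarrow> P (N \<omega>) \<omega>" for \<omega>
    unfolding disconnected_poisson_points_iff[OF r] P_def Ball_def Bex_def Pow_iff ..
  ultimately show ?thesis by (simp add: pred_def)
qed

text \<open>A point in the inner ball with no other in the ball of twice the radius has distance at
  least \<open>\<rho> \<ge> r\<close> from the rest. Centres \<open>4 * \<rho>\<close> apart make
  the larger balls disjoint, hence the events pairwise independent.\<close>

lemma prob_disconnected_poisson_graph:
  fixes X :: "nat \<Rightarrow> 'w \<Rightarrow> 'a::euclidean_space" and z :: "nat \<Rightarrow> 'a"
  assumes ps: "poisson_sample c \<nu> M N X" and c: "c > 0" and r: "0 < r" "r \<le> \<rho>"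
    and sep: "\<And>i j. i < K \<Longrightarrow> j < K \<Longrightarrow> i \<noteq> j \<Longrightarrow> 4 * \<rho> \<le> dist (z i) (z j)"
    and p: "\<And>i. i < K \<Longrightarrow>
      p \<le> c * measure \<nu> (ball (z i) \<rho>) * exp (- c * measure \<nu> (ball (z i) (2 * \<rho>)))"
    and K: "2 \<le> real K * p"
  shows "1 - 4 / (real K * p) \<le>
    measure M {\<omega>\<in>space M. disconnected_graph (geometric_graph (poisson_points N X \<omega>) r)}"
proof -
  interpret prob_space M using ps by (rule poisson_sampleD)
  define E where "E = (\<lambda>i. isolated_event M N X (ball (z i) \<rho>) (ball (z i) (2 * \<rho>)))"
  have sub: "ball (z i) \<rho> \<subseteq> ball (z i) (2 * \<rho>)" for i using r by (intro subset_ball) simp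
  have disj: "ball (z i) (2 * \<rho>) \<inter> ball (z j) (2 * \<rho>) = {}" if "i < K" "j < K" "i \<noteq> j" for i j
  proof (rule ccontr)
    assume "\<not> ?thesis"
    then obtain x where "dist (z i) x < 2 * \<rho>" "dist (z j) x < 2 * \<rho>" by auto
    then show False using sep[OF that] dist_triangle2[of "z i" "z j" x] by linarith
  qed
  have "1 - 4 / (real K * p) \<le> prob {\<omega>\<in>space M. \<exists>i<K. \<exists>j<K. i \<noteq> j \<and> \<omega> \<in> E i \<and> \<omega> \<in> E j}"
  proof (rule two_of_pairwise_independent_events)
    show "E i \<in> events" for i
      unfolding E_def by (rule sets_isolated_event[OF ps]) auto
    show "prob (E i \<inter> E j) = prob (E i) * prob (E j)" if "i < K" "j < K" "i \<noteq> j" for i j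
      unfolding E_def using sub disj[OF that] by (intro prob_isolated_event_Int[OF ps c]) auto
    show "p \<le> prob (E i)" if "i < K" for i
      unfolding E_def using p[OF that] sub by (subst prob_isolated_event[OF ps c]) auto
  qed (rule K)
  also have "\<dots> \<le> prob {\<omega>\<in>space M. disconnected_graph (geometric_graph (poisson_points N X \<omega>) r)}"
  proof (rule finite_measure_mono)
    show "{\<omega>\<in>space M. \<exists>i<K. \<exists>j<K. i \<noteq> j \<and> \<omega> \<in> E i \<and> \<omega> \<in> E j} \<subseteq>
        {\<omega>\<in>space M. disconnected_graph (geometric_graph (poisson_points N X \<omega>) r)}"
    proof
      fix \<omega> assume "\<omega> \<in> {\<omega>\<in>space M. \<exists>i<K. \<exists>j<K. i \<noteq> j \<and> \<omega> \<in> E i \<and> \<omega> \<in> E j}"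
      then obtain i j where ij: "\<omega> \<in> space M" "i < K" "j < K" "i \<noteq> j" "\<omega> \<in> E i" "\<omega> \<in> E j" by blast
      from \<open>\<omega> \<in> E i\<close> obtain a where a: "a < N \<omega>" "X a \<omega> \<in> ball (z i) \<rho>"
          "\<And>k. k < N \<omega> \<Longrightarrow> k \<noteq> a \<Longrightarrow> X k \<omega> \<notin> ball (z i) (2 * \<rho>)"
        unfolding E_def isolated_event_def by blast
      from \<open>\<omega> \<in> E j\<close> obtain b where b: "b < N \<omega>" "X b \<omega> \<in> ball (z j) \<rho>"
        unfolding E_def isolated_event_def by blast
      \<comment> \<open>The second event supplies a point outside \<open>{a}\<close>, so that this
        is a proper cut.\<close>
      have "a \<noteq> b" using a(2) b(2) sub disj[OF ij(2-4)] by blast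
      moreover have "r \<le> dist (X a \<omega>) (X k \<omega>)" if "k < N \<omega>" "k \<noteq> a" for k
        using a(2) a(3)[OF that] r dist_triangle[of "z i" "X k \<omega>" "X a \<omega>"] by simp
      moreover have "b \<in> {..<N \<omega>}" "{a} \<subseteq> {..<N \<omega>}" using a(1) b(1) by auto
      ultimately have "disconnected_graph (geometric_graph (poisson_points N X \<omega>) r)"
        unfolding disconnected_poisson_points_iff[OF r(1)]
        by (intro disjI2 exI[of _ "{a}"] conjI) (assumption | force)+
      then show "\<omega> \<in> {\<omega>\<in>space M. disconnected_graph (geometric_graph (poisson_points N X \<omega>) r)}"
        using ij(1) by simp
    qed
    show "{\<omega>\<in>space M. disconnected_graph (geometric_graph (poisson_points N X \<omega>) r)} \<in> events"
      using ps r(1) by (rule sets_disconnected_poisson_graph)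
  qed
  finally show ?thesis .
qed

section \<open>Disconnectedness\<close>

text \<open>A finite connected set has at most one point, whereas the sphere contains antipodes.
  This is where the dimension enters: on the line there are only two directions.\<close>

lemma infinite_sphere:
  assumes "DIM('a::euclidean_space) \<ge> 2"
  shows "infinite (sphere (0::'a) 1)"
proof
  assume "finite (sphere (0::'a) 1)"
  then consider "sphere (0::'a) 1 = {}" | a where "sphere (0::'a) 1 = {a}"
    using connected_finite_iff_sing[OF connected_sphere[OF assms, of 0 1]] by blast
  then show False
  proof cases
    case 1
    then show False using vector_choose_size[of 1, where 'a='a] by auto
  next
    case 2
    have "a \<in> sphere 0 1" unfolding 2 by simp
    then have "norm a = 1" "- a \<in> sphere 0 1" by simp_all
    then have "- a = a" unfolding 2 by simp
    then have "a + - a = a + a" by simp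
    then have "2 *\<^sub>R a = 0" by (simp add: scaleR_2)
    then show False using \<open>norm a = 1\<close> by simp
  qed
qed

lemma measure_density_ball_bounds:
  fixes q :: "'a::euclidean_space \<Rightarrow> real"
  assumes [measurable]: "q \<in> borel_measurable borel"
    and prob: "prob_space (density lborel (\<lambda>x. ennreal (q x)))" and \<rho>: "\<rho> > 0" and lo: "lo \<ge> 0"
    and bounds: "\<And>x. x \<in> ball c \<rho> \<Longrightarrow> lo \<le> q x \<and> q x \<le> hi"
  shows "lo * (unit_ball_vol (real DIM('a)) * \<rho> ^ DIM('a)) \<le>
      measure (density lborel (\<lambda>x. ennreal (q x))) (ball c \<rho>)"
    and "measure (density lborel (\<lambda>x. ennreal (q x))) (ball c \<rho>) \<le>
      hi * (unit_ball_vol (real DIM('a)) * \<rho> ^ DIM('a))"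
proof -
  let ?\<nu> = "density lborel (\<lambda>x. ennreal (q x))" and ?v = "unit_ball_vol (real DIM('a)) * \<rho> ^ DIM('a)"
  interpret prob_space ?\<nu> by (rule prob)
  have v: "emeasure lborel (ball c \<rho>) = ennreal ?v" "?v \<ge> 0"
    using \<rho> by (auto simp: emeasure_ball)
  have hi: "hi \<ge> 0" using bounds[of c] \<rho> lo by auto
  have e: "emeasure ?\<nu> (ball c \<rho>) = (\<integral>\<^sup>+x. ennreal (q x) * indicator (ball c \<rho>) x \<partial>lborel)"
    by (rule emeasure_density) auto
  have const: "(\<integral>\<^sup>+x. ennreal k * indicator (ball c \<rho>) x \<partial>lborel) = ennreal (k * ?v)" if "k \<ge> 0" for k
    using that v by (subst nn_integral_cmult_indicator) (auto simp: ennreal_mult)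
  have "ennreal (lo * ?v) \<le> emeasure ?\<nu> (ball c \<rho>)"
    unfolding e const[OF lo, symmetric] using bounds
    by (intro nn_integral_mono) (auto simp: indicator_def intro: ennreal_leI)
  then show "lo * ?v \<le> prob (ball c \<rho>)"
    by (simp add: emeasure_eq_measure)
  have "emeasure ?\<nu> (ball c \<rho>) \<le> ennreal (hi * ?v)"
    unfolding e const[OF hi, symmetric] using bounds
    by (intro nn_integral_mono) (auto simp: indicator_def intro: ennreal_leI)
  then show "prob (ball c \<rho>) \<le> hi * ?v"
    using hi v by (simp add: emeasure_eq_measure)
qed

theorem theorem4p2:
  fixes q :: "'a::euclidean_space \<Rightarrow> real"
    and \<psi> \<phi> :: "real \<Rightarrow> real"
    and r :: "nat \<Rightarrow> real"
    and M :: "nat \<Rightarrow> 'w measure"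
    and N :: "nat \<Rightarrow> 'w \<Rightarrow> nat"
    and X :: "nat \<Rightarrow> nat \<Rightarrow> 'w \<Rightarrow> 'a"
  assumes dim: "DIM('a) \<ge> 2"
    and q_measurable: "q \<in> borel_measurable borel"
    and q_pos: "\<And>x. q x > 0"
    and q_density: "prob_space (density lborel (\<lambda>x. ennreal (q x)))"
    and q_radial: "radial q"
    and r_range: "\<And>n. n \<ge> 1 \<Longrightarrow> 0 < r n \<and> r n \<le> 1"
    and r_antimono: "antimono_on {1..} r"
    and sample: "\<And>n. n \<ge> 1 \<Longrightarrow>
      poisson_sample (real n) (density lborel (\<lambda>x. ennreal (q x))) (M n) (N n) (X n)"
    and decay: "exponential_decay q \<psi>"
    and inverse: "asymptotic_inverse \<psi> \<phi>"
    and radius_bound: "(\<lambda>n. r n * deriv \<psi> (\<phi> (ln (real n)))) \<in> O(\<lambda>_. 1)"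
  shows "(\<lambda>n. measure (M n)
            {\<omega> \<in> space (M n). disconnected_graph (geometric_graph (poisson_points (N n) (X n) \<omega>) (r n))})
          \<longlonglongrightarrow> 1"
proof -
  define \<nu> where "\<nu> = density lborel (\<lambda>x::'a. ennreal (q x))"
  define V where "V = unit_ball_vol (real DIM('a))"
  have V: "V > 0" by (simp add: V_def)
  have light: "light_tail q \<psi>" and rv: "regularly_varying 1 \<psi>"
    using decay by (auto simp: exponential_decay_def)
  have \<psi>_top: "filterlim \<psi> at_top at_top"
    using light by (simp add: light_tail_def von_mises_def)
  obtain L \<alpha> where L: "\<And>z. z > 0 \<Longrightarrow> L z > 0" "regularly_varying \<alpha> L"
      "\<And>x. q x = L (norm x) * exp (- \<psi> (norm x))"
    using light unfolding light_tail_def by blast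
  obtain z0 where mono: "mono_on {z0..} (deriv \<psi>) \<or> antimono_on {z0..} (deriv \<psi>)"
    using light unfolding light_tail_def by blast
  note der = light_tail_derivative[OF light]
  have cont: "continuous_on {0<..} \<psi>"
    using der by (intro continuous_at_imp_continuous_on ballI DERIV_isCont) auto
  have bounds: "\<forall>\<^sub>F z in at_top. \<psi> z / (2 * z) \<le> deriv \<psi> z \<and> deriv \<psi> z \<le> 2 * \<psi> z / z"
    by (rule monotone_density[OF der mono rv])
  \<comment> \<open>Measurability of \<open>L\<close> is not assumed; it is recovered from that of
    \<open>q\<close> along a ray and the continuity of \<psi>.\<close>
  have meas: "(\<lambda>x. ln (L (exp x))) \<in> borel_measurable borel"
  proof -
    obtain e :: 'a where e: "norm e = 1" using vector_choose_size[of 1] by auto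
    have "continuous_on UNIV (\<lambda>x. \<psi> (exp x))"
      by (rule continuous_on_compose2[OF cont]) (auto intro!: continuous_intros)
    then have [measurable]: "(\<lambda>x. \<psi> (exp x)) \<in> borel_measurable borel"
      by (rule borel_measurable_continuous_onI)
    note [measurable] = q_measurable
    have "L (exp x) = q (exp x *\<^sub>R e) * exp (\<psi> (exp x))" for x
      using e by (simp add: L(3) exp_minus)
    then show ?thesis by simp
  qed
  obtain cL where L_osc: "\<forall>\<^sub>F s in at_top. \<forall>t\<in>{s..exp 1 * s}. \<bar>ln (L t) - ln (L s)\<bar> \<le> cL"
    using regularly_varying_slow_variation(1)[OF L(1,2) meas] by blast
  obtain A where L_growth: "\<forall>\<^sub>F z in at_top. \<bar>ln (L z)\<bar> \<le> A * ln z"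
    using regularly_varying_slow_variation(2)[OF L(1,2) meas] by blast
  obtain C where C: "C > 0" "\<forall>\<^sub>F n in sequentially. norm (r n * deriv \<psi> (\<phi> (ln (real n)))) \<le> C * norm (1::real)"
    using radius_bound by (rule landau_o.bigE)
  \<comment> \<open>The factor 2 compensates the 2 in
    \<open>\<psi> z / (2 * z) \<le> deriv \<psi> z\<close>: together with
    \<open>r n * deriv \<psi> (Y n) \<le> C\<close> it yields
    \<open>r n \<le> \<rho> (Y n)\<close>.\<close>
  define \<rho> where "\<rho> = (\<lambda>Y. min 1 (2 * C * Y / \<psi> Y))"
  have "\<exists>c1>0. \<exists>c2. \<forall>\<^sub>F Y in at_top. \<exists>R\<ge>Y/2. \<forall>s. \<bar>s - R\<bar> \<le> 2 * \<rho> Y \<longrightarrow>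
      c1 \<le> exp (\<psi> Y) * (L s * exp (- \<psi> s)) * \<rho> Y ^ DIM('a) \<and>
      exp (\<psi> Y) * (L s * exp (- \<psi> s)) * \<rho> Y ^ DIM('a) \<le> c2"
    unfolding \<rho>_def
    by (rule critical_radius[OF der bounds rv L(1) L_osc L_growth]) (use C(1) in simp_all)
  then obtain c1 c2 where c1: "c1 > 0" and crit: "\<forall>\<^sub>F Y in at_top. \<exists>R\<ge>Y/2. \<forall>s. \<bar>s - R\<bar> \<le> 2 * \<rho> Y \<longrightarrow>
      c1 \<le> exp (\<psi> Y) * (L s * exp (- \<psi> s)) * \<rho> Y ^ DIM('a) \<and>
      exp (\<psi> Y) * (L s * exp (- \<psi> s)) * \<rho> Y ^ DIM('a) \<le> c2"
    by (elim exE conjE) (rule that)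
  \<comment> \<open>The expected number of points is at least \<open>c1 * V\<close> in an inner ball
    and at most \<open>c2 * V * 2 ^ DIM('a)\<close> in an outer one. The resulting bound depends
    neither on \<open>n\<close> nor on the direction.\<close>
  define p where "p = c1 * V * exp (- (c2 * V * 2 ^ DIM('a)))"
  have p: "p > 0" using c1 V by (simp add: p_def)
  define Y where "Y = (\<lambda>n. \<phi> (ln (real n)))"
  have ln_top: "filterlim (\<lambda>n. ln (real n)) at_top sequentially"
    by (rule filterlim_compose[OF ln_at_top filterlim_real_sequentially])
  have Y_top: "filterlim Y at_top sequentially"
    unfolding Y_def
    by (rule filterlim_compose[OF asymptotic_inverse_at_top[OF inverse cont \<psi>_top] ln_top])
  have \<psi>_Y: "\<forall>\<^sub>F n in sequentially. \<psi> (Y n) = ln (real n)"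
    unfolding Y_def using inverse ln_top
    by (auto simp: asymptotic_inverse_def intro: eventually_compose_filterlim)
  obtain u :: "nat \<Rightarrow> 'a" where u: "inj u" "range u \<subseteq> sphere 0 1"
    using infinite_countable_subset[OF infinite_sphere[OF dim]] by blast
  let ?P = "\<lambda>n. measure (M n) {\<omega> \<in> space (M n).
      disconnected_graph (geometric_graph (poisson_points (N n) (X n) \<omega>) (r n))}"
  have lower: "\<forall>\<^sub>F n in sequentially. 1 - 4 / (real K * p) \<le> ?P n" if K: "2 \<le> real K * p" for K
  proof -
    \<comment> \<open>With \<open>R \<ge> Y n / 2\<close> and \<rho> at most 1 this gives the
      separation \<open>4 * \<rho>\<close> of the centres.\<close>
    have "\<forall>\<^sub>F n in sequentially. 4 \<le> Y n / 2 * dist (u i) (u j)" if "i \<noteq> j" for i j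
    proof -
      have d: "dist (u i) (u j) > 0" using that u(1) by (simp add: inj_eq)
      have "\<forall>\<^sub>F n in sequentially. 8 / dist (u i) (u j) \<le> Y n"
        using Y_top by (simp add: filterlim_at_top)
      then show ?thesis using d by (simp add: field_simps)
    qed
    then have "\<forall>\<^sub>F n in sequentially. \<forall>i\<in>{..<K}. \<forall>j\<in>{..<K}. i \<noteq> j \<longrightarrow> 4 \<le> Y n / 2 * dist (u i) (u j)"
      by (intro eventually_ball_finite ballI) (auto intro: eventually_mono)
    then show ?thesis
      using \<psi>_Y C(2) eventually_compose_filterlim[OF bounds Y_top]
        eventually_compose_filterlim[OF crit Y_top] eventually_gt_at_top[of 1]
        eventually_compose_filterlim[OF eventually_gt_at_top[of 0] Y_top]
    proof eventually_elim
      case (elim n)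
      have n: "real n > 0" "n \<ge> 1" "ln (real n) > 0" using elim by auto
      obtain R where R: "R \<ge> Y n / 2" "\<And>s. \<bar>s - R\<bar> \<le> 2 * \<rho> (Y n) \<Longrightarrow>
          c1 \<le> real n * (L s * exp (- \<psi> s)) * \<rho> (Y n) ^ DIM('a) \<and>
          real n * (L s * exp (- \<psi> s)) * \<rho> (Y n) ^ DIM('a) \<le> c2"
        using elim n by auto
      have \<rho>: "0 < \<rho> (Y n)" "\<rho> (Y n) \<le> 1"
        using elim n C(1) by (auto simp: \<rho>_def)
      have "r n \<le> \<rho> (Y n)"
      proof -
        have "r n * (ln (real n) / (2 * Y n)) \<le> r n * deriv \<psi> (Y n)"
          using elim r_range[OF n(2)] by (intro mult_left_mono) auto
        also have "\<dots> \<le> C" using elim by (simp add: Y_def abs_le_iff)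
        finally have "r n \<le> 2 * C * Y n / \<psi> (Y n)"
          using elim n by (simp add: field_simps)
        then show ?thesis using r_range[OF n(2)] by (simp add: \<rho>_def)
      qed
      \<comment> \<open>Dividing the critical bounds by \<open>k\<close> turns them into bounds on
        \<open>q\<close>; the volume of a ball then cancels the power of \<rho>.\<close>
      define k where "k = real n * \<rho> (Y n) ^ DIM('a)"
      have k: "k > 0" using n \<rho> by (simp add: k_def)
      have q_bounds: "c1 / k \<le> q x \<and> q x \<le> c2 / k" if "x \<in> ball (R *\<^sub>R u i) (2 * \<rho> (Y n))" for i x
      proof -
        have "u i \<in> sphere 0 1" using u(2) by blast
        then have "norm (u i) = 1" by simp
        then have "norm (R *\<^sub>R u i) = R" using R(1) elim by simp
        moreover have "\<bar>norm x - norm (R *\<^sub>R u i)\<bar> \<le> dist (R *\<^sub>R u i) x"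
          by (metis dist_norm norm_minus_commute norm_triangle_ineq3)
        ultimately have "\<bar>norm x - R\<bar> \<le> 2 * \<rho> (Y n)" using that by simp
        from R(2)[OF this] have "c1 \<le> q x * k" "q x * k \<le> c2"
          by (simp_all add: L(3) k_def mult_ac)
        then show ?thesis using k by (simp add: field_simps)
      qed
      have sub: "ball (R *\<^sub>R u i) (\<rho> (Y n)) \<subseteq> ball (R *\<^sub>R u i) (2 * \<rho> (Y n))" for i
        using \<rho> by (intro subset_ball) simp
      show "1 - 4 / (real K * p) \<le> ?P n"
      proof (rule prob_disconnected_poisson_graph[OF sample[OF n(2)] n(1) _ \<open>r n \<le> \<rho> (Y n)\<close> _ _ K])
        show "0 < r n" using r_range[OF n(2)] by simp
        show "4 * \<rho> (Y n) \<le> dist (R *\<^sub>R u i) (R *\<^sub>R u j)" if "i < K" "j < K" "i \<noteq> j" for i j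
        proof -
          have "4 * \<rho> (Y n) \<le> Y n / 2 * dist (u i) (u j)"
            using elim(1) that \<rho> by fastforce
          also have "\<dots> \<le> R * dist (u i) (u j)" using R(1) by (intro mult_right_mono) auto
          also have "\<dots> = dist (R *\<^sub>R u i) (R *\<^sub>R u j)"
            using R(1) elim by (simp add: dist_norm flip: scaleR_diff_right)
          finally show ?thesis .
        qed
        show "p \<le> real n * measure (density lborel (\<lambda>x. ennreal (q x))) (ball (R *\<^sub>R u i) (\<rho> (Y n))) *
            exp (- real n * measure (density lborel (\<lambda>x. ennreal (q x))) (ball (R *\<^sub>R u i) (2 * \<rho> (Y n))))"
          if "i < K" for i
        proof -
          have "c1 / k * (V * \<rho> (Y n) ^ DIM('a)) \<le> measure \<nu> (ball (R *\<^sub>R u i) (\<rho> (Y n)))"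
            unfolding V_def \<nu>_def
          proof (rule measure_density_ball_bounds(1)[OF q_measurable q_density \<rho>(1)])
            show "c1 / k \<le> q x \<and> q x \<le> c2 / k" if "x \<in> ball (R *\<^sub>R u i) (\<rho> (Y n))" for x
              using q_bounds sub that by blast
          qed (use c1 k in simp)
          then have lower_mass: "c1 * V \<le> real n * measure \<nu> (ball (R *\<^sub>R u i) (\<rho> (Y n)))"
            using n \<rho> by (simp add: k_def field_simps)
          have "measure \<nu> (ball (R *\<^sub>R u i) (2 * \<rho> (Y n))) \<le> c2 / k * (V * (2 * \<rho> (Y n)) ^ DIM('a))"
            unfolding V_def \<nu>_def using q_bounds \<rho> c1 k
            by (intro measure_density_ball_bounds(2)[OF q_measurable q_density, where lo = "c1 / k"]) auto
          then have "real n * measure \<nu> (ball (R *\<^sub>R u i) (2 * \<rho> (Y n))) \<le> c2 * V * 2 ^ DIM('a)"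
            using n \<rho> by (simp add: k_def field_simps power_mult_distrib)
          then have "c1 * V * exp (- (c2 * V * 2 ^ DIM('a))) \<le>
              real n * measure \<nu> (ball (R *\<^sub>R u i) (\<rho> (Y n))) *
              exp (- (real n * measure \<nu> (ball (R *\<^sub>R u i) (2 * \<rho> (Y n)))))"
            by (intro mult_mono[OF lower_mass]) auto
          then show ?thesis by (simp add: p_def \<nu>_def)
        qed
      qed
    qed
  qed
  show ?thesis
  proof (rule tendstoI)
    fix \<epsilon> :: real assume \<epsilon>: "\<epsilon> > 0"
    \<comment> \<open>The number of directions depends on \<epsilon> alone, as \<open>p\<close> is
      fixed; only afterwards is \<open>n\<close> taken large.\<close>
    obtain K where K: "real K > max (2 / p) (4 / (\<epsilon> * p))"
      using reals_Archimedean2 by blast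
    then have "2 \<le> real K * p" and small: "4 / (real K * p) < \<epsilon>"
      using p \<epsilon> by (auto simp: field_simps)
    from lower[OF this(1)] show "\<forall>\<^sub>F n in sequentially. dist (?P n) 1 < \<epsilon>"
      using eventually_ge_at_top[of 1]
    proof eventually_elim
      case (elim n)
      have "?P n \<le> 1"
        using prob_space.prob_le_1[OF poisson_sampleD(1)[OF sample]] elim by blast
      then show ?case using elim small by (simp add: dist_real_def)
    qed
  qed
qed

end
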